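(* Let $\{G(n)\}$ be a sequence of random intersection graphs with $\mathbb E\,Y(n)=\Theta(1)$ and $\mathrm{Var}(Y(n))=O(1)$. Then $$d_{TV}\Big(\omega'(G(n)),\ M\big(\lfloor (mn)^{1/2}\mathbb E\,Y(n)\rfloor,\ m\big)\Big)\to0 .$$
   Context: Random intersection graph: given positive integers $n,m$ and a probability measure $P$ on $\{0,1,\dots,m\}$, $G(n,m,P)$ has vertex set $V=[n]$ and attribute set $W=\{w_1,\dots,w_m\}$; independent random subsets $S_1,\dots,S_n\subseteq W$ are drawn with $\mathbb P(S_v=S)=P(|S|)/\binom{m}{|S|}$, and distinct $u,v$ are adjacent iff $S_u\cap S_v\neq\emptyset$. For a sequence $G(n)=G(n,m(n),P(n))$ with $m(n)\to\infty$, $X(n)$ has law $P(n)$ and $Y(n)=(n/m)^{1/2}X(n)$. $\omega'(G(n))=\max_{w\in W}|\{v: w\in S_v\}|$. $M(N,m)$ is the maximum number of balls in a bin after $N$ balls are thrown independently and uniformly at random into $m$ bins. $d_{TV}(\xi,\eta)=\frac12\sum_{i\ge0}|\mathbb P(\xi=i)-\mathbb P(\eta=i)|$ for nonnegative integer valued $\xi,\eta$. *)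

theory Defs
  imports "HOL-Probability.Probability" "HOL-Library.Landau_Symbols"
begin

text \<open>Attributes are w_0,...,w_{m-1}, i.e. the set {..<m}; vertices are {..<n}.\<close>

text \<open>Law of one random attribute set S_v: P(S_v = S) = P(|S|) / (m choose |S|),
  i.e. draw the size k according to P, then a uniform k-subset of the m attributes.\<close>
definition attr_set_pmf :: "nat \<Rightarrow> nat pmf \<Rightarrow> nat set pmf" where
  "attr_set_pmf m P = do { k \<leftarrow> P; pmf_of_set {S. S \<subseteq> {..<m} \<and> card S = k} }"

definition attr_sets_pmf :: "nat \<Rightarrow> nat \<Rightarrow> nat pmf \<Rightarrow> (nat \<Rightarrow> nat set) pmf" where
  "attr_sets_pmf n m P = Pi_pmf {..<n} {} (\<lambda>_. attr_set_pmf m P)"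

definition omega' :: "nat \<Rightarrow> nat \<Rightarrow> (nat \<Rightarrow> nat set) \<Rightarrow> nat" where
  "omega' n m S = Max ((\<lambda>w. card {v\<in>{..<n}. w \<in> S v}) ` {..<m})"

definition omega'_pmf :: "nat \<Rightarrow> nat \<Rightarrow> nat pmf \<Rightarrow> nat pmf" where
  "omega'_pmf n m P = map_pmf (omega' n m) (attr_sets_pmf n m P)"

definition max_load_pmf :: "nat \<Rightarrow> nat \<Rightarrow> nat pmf" where
  "max_load_pmf N m =
     map_pmf (\<lambda>f. Max ((\<lambda>b. card {i\<in>{..<N}. f i = b}) ` {..<m}))
       (Pi_pmf {..<N} 0 (\<lambda>_. pmf_of_set {..<m}))"

definition dTV :: "nat pmf \<Rightarrow> nat pmf \<Rightarrow> real" where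
  "dTV p q = (1/2) * (\<Sum>i. \<bar>pmf p i - pmf q i\<bar>)"

definition EY :: "nat \<Rightarrow> nat \<Rightarrow> nat pmf \<Rightarrow> real" where
  "EY n m P = measure_pmf.expectation P (\<lambda>x. sqrt (real n / real m) * real x)"

definition VarY :: "nat \<Rightarrow> nat \<Rightarrow> nat pmf \<Rightarrow> real" where
  "VarY n m P = measure_pmf.variance P (\<lambda>x. sqrt (real n / real m) * real x)"

end

theory Submission
  imports Defs
begin

text \<open>Condition on the sizes \<open>x v\<close> of the attribute sets and put \<open>T = \<Sum>v<n. x v\<close>. Throw \<open>x v\<close> balls for
  each vertex \<open>v\<close> into the \<open>m\<close> bins and, given the balls, let \<open>S v\<close> be a uniform \<open>x v\<close>-subset of the
  bins containing those hit by \<open>v\<close>. By symmetry every ball of \<open>v\<close> is uniform in \<open>S v\<close> given the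
  sets, so the maximal load has at least the mean of \<open>omega'\<close>. Conversely \<open>omega'\<close> is at least the
  maximal load minus the number of repetitions within vertices in the fullest bin. Hence the
  \<open>L\<^sup>1\<close>-distance of the two is at most twice the expected number of these repetitions, which by
  exchangeability of the balls is a multiple of \<open>E[M (M - 1)] / (T (T - 1))\<close>, with \<open>M\<close> the maximal load.

  Exchangeability also shows that \<open>|N - T|\<close> further balls raise \<open>E M\<close> by at most \<open>|N - T| E M / N\<close>.
  Counting triples of balls in a common bin gives \<open>E M = O(1 + N m\<^bsup>-2/3\<^esup>)\<close> and
  \<open>E[M (M - 1)] = O(1 + N\<^sup>2 m\<^bsup>-4/3\<^esup>)\<close>. As \<open>T\<close> has standard deviation \<open>O(\<surd>m)\<close> around \<open>\<mu> = \<surd>(m n) E Y\<close>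
  and \<open>\<Sum>v<n. x v\<^sup>2\<close> has mean \<open>O(m)\<close>, all contributions vanish.\<close>

section \<open>Expectations over finitely supported laws\<close>

lemma expectation_mono_finite:
  fixes f g :: "'a \<Rightarrow> real"
  assumes "finite (set_pmf p)" and "\<And>x. x \<in> set_pmf p \<Longrightarrow> f x \<le> g x"
  shows "measure_pmf.expectation p f \<le> measure_pmf.expectation p g"
proof (rule integral_mono_AE)
  show "integrable p f" "integrable p g"
    using assms(1) by (rule integrable_measure_pmf_finite)+
  show "AE x in p. f x \<le> g x"
    using assms(2) by (simp add: AE_measure_pmf_iff)
qed

lemma expectation_sum_finite:
  fixes f :: "'b \<Rightarrow> 'a \<Rightarrow> real"
  assumes "finite (set_pmf p)"
  shows "measure_pmf.expectation p (\<lambda>x. \<Sum>i\<in>A. f i x) = (\<Sum>i\<in>A. measure_pmf.expectation p (f i))"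
  by (rule Bochner_Integration.integral_sum) (rule integrable_measure_pmf_finite[OF assms])

lemma expectation_cong_pmf:
  fixes f g :: "'a \<Rightarrow> real"
  assumes "\<And>x. x \<in> set_pmf p \<Longrightarrow> f x = g x"
  shows "measure_pmf.expectation p f = measure_pmf.expectation p g"
  by (rule integral_cong_AE) (simp_all add: AE_measure_pmf_iff assms)

lemma card_eq_sum_of_bool: "finite A \<Longrightarrow> real (card {x \<in> A. Q x}) = (\<Sum>x\<in>A. of_bool (Q x))"
  by (simp add: of_bool_def sum.If_cases Int_def)

subsection \<open>Total variation distance\<close>

lemma summable_pmf_nat: "summable (pmf (p :: nat pmf))"
  and suminf_pmf_nat: "(\<Sum>i. pmf p i) = 1"
proof -
  have *: "(\<Sum>i. ennreal (pmf p i)) = 1"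
    by (metis nn_integral_count_space_nat nn_integral_pmf measure_pmf.emeasure_space_1
        space_measure_pmf)
  show "summable (pmf p)"
    by (rule summable_suminf_not_top) (use * in auto)
  then have "ennreal (\<Sum>i. pmf p i) = 1"
    using * by (simp add: suminf_ennreal2)
  then show "(\<Sum>i. pmf p i) = 1" by simp
qed

lemma summable_dTV: "summable (\<lambda>i. \<bar>pmf p i - pmf q i\<bar>)" for p q :: "nat pmf"
  by (rule summable_comparison_test'[where g = "\<lambda>i. pmf p i + pmf q i" and N = 0])
    (auto intro: summable_add summable_pmf_nat simp: abs_le_iff add_increasing add_increasing2
      intro!: order.trans[OF abs_triangle_ineq4])

lemma dTV_nonneg: "0 \<le> dTV p q"
  unfolding dTV_def by (simp add: suminf_nonneg summable_dTV)

lemma dTV_le_1: "dTV p q \<le> 1"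
proof -
  have "(\<Sum>i. \<bar>pmf p i - pmf q i\<bar>) \<le> (\<Sum>i. pmf p i + pmf q i)"
    by (intro suminf_le summable_dTV summable_add summable_pmf_nat)
      (auto intro!: order.trans[OF abs_triangle_ineq4])
  also have "\<dots> = 2"
    by (simp add: suminf_add[symmetric] summable_pmf_nat suminf_pmf_nat)
  finally show ?thesis by (simp add: dTV_def)
qed

lemma dTV_refl [simp]: "dTV p p = 0"
  by (simp add: dTV_def)

lemma dTV_commute: "dTV p q = dTV q p"
  by (simp add: dTV_def abs_minus_commute)

lemma dTV_triangle: "dTV p r \<le> dTV p q + dTV q r"
proof -
  have "(\<Sum>i. \<bar>pmf p i - pmf r i\<bar>) \<le> (\<Sum>i. \<bar>pmf p i - pmf q i\<bar> + \<bar>pmf q i - pmf r i\<bar>)"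
    by (intro suminf_le summable_dTV summable_add) auto
  then show ?thesis
    by (simp add: dTV_def suminf_add[symmetric] summable_dTV)
qed

text \<open>Total variation is convex under mixing by a common law: apply the triangle inequality
  inside the finite mixture, then exchange the mixture with the series over values.\<close>

lemma dTV_bind_le:
  fixes p :: "'a pmf"
  assumes fin: "finite (set_pmf p)"
  shows "dTV (bind_pmf p f) (bind_pmf p g) \<le> measure_pmf.expectation p (\<lambda>x. dTV (f x) (g x))"
proof -
  let ?S = "set_pmf p"
  have E: "measure_pmf.expectation p h = (\<Sum>x\<in>?S. pmf p x * h x)" for h :: "'a \<Rightarrow> real"
    by (subst integral_measure_pmf[OF fin]) auto
  have "(\<Sum>i. \<bar>pmf (bind_pmf p f) i - pmf (bind_pmf p g) i\<bar>)
      \<le> (\<Sum>i. \<Sum>x\<in>?S. pmf p x * \<bar>pmf (f x) i - pmf (g x) i\<bar>)"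
  proof (intro suminf_le summable_dTV summable_sum summable_mult)
    fix i
    have "\<bar>pmf (bind_pmf p f) i - pmf (bind_pmf p g) i\<bar>
        = \<bar>\<Sum>x\<in>?S. pmf p x * (pmf (f x) i - pmf (g x) i)\<bar>"
      by (simp add: pmf_bind E sum_subtractf right_diff_distrib)
    also have "\<dots> \<le> (\<Sum>x\<in>?S. \<bar>pmf p x * (pmf (f x) i - pmf (g x) i)\<bar>)"
      by (rule sum_abs)
    finally show "\<bar>pmf (bind_pmf p f) i - pmf (bind_pmf p g) i\<bar>
        \<le> (\<Sum>x\<in>?S. pmf p x * \<bar>pmf (f x) i - pmf (g x) i\<bar>)"
      by (simp add: abs_mult)
  qed
  also have "\<dots> = (\<Sum>x\<in>?S. pmf p x * (\<Sum>i. \<bar>pmf (f x) i - pmf (g x) i\<bar>))"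
    by (simp add: suminf_sum suminf_mult summable_dTV summable_mult)
  finally show ?thesis
    by (simp add: dTV_def E sum_distrib_left mult.left_commute)
qed

text \<open>The coupling inequality: with both variables realised on the common space
  \<open>p\<close>, the distance is at most the chance that they differ, and different integers are
  at least 1 apart.\<close>

lemma dTV_map_le:
  assumes "finite (set_pmf p)"
  shows "dTV (map_pmf f p) (map_pmf g p)
      \<le> measure_pmf.expectation p (\<lambda>x. \<bar>real (f x) - real (g x)\<bar>)"
proof -
  have "dTV (return_pmf a) (return_pmf b) \<le> \<bar>real a - real b\<bar>" for a b
  proof (cases "a = b")
    case False
    then have "1 \<le> \<bar>real a - real b\<bar>" by linarith
    then show ?thesis using dTV_le_1 order.trans by blast
  qed simp
  then have "measure_pmf.expectation p (\<lambda>x. dTV (return_pmf (f x)) (return_pmf (g x)))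
      \<le> measure_pmf.expectation p (\<lambda>x. \<bar>real (f x) - real (g x)\<bar>)"
    using assms by (intro expectation_mono_finite)
  then show ?thesis
    unfolding map_pmf_def by (rule order.trans[OF dTV_bind_le[OF assms]])
qed

subsection \<open>Balls in bins\<close>

definition load :: "'a set \<Rightarrow> ('a \<Rightarrow> nat) \<Rightarrow> nat \<Rightarrow> nat" where
  "load I f b = card {i \<in> I. f i = b}"

definition max_load :: "'a set \<Rightarrow> nat \<Rightarrow> ('a \<Rightarrow> nat) \<Rightarrow> nat" where
  "max_load I m f = Max (load I f ` {..<m})"

text \<open>The choice depends on \<open>f\<close> only through its loads, so ties are broken
  independently of the labels of the balls; hence the bin is invariant under permuting
  balls.\<close>

definition top_bin :: "'a set \<Rightarrow> nat \<Rightarrow> ('a \<Rightarrow> nat) \<Rightarrow> nat" where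
  "top_bin I m f = (SOME b. b < m \<and> load I f b = max_load I m f)"

text \<open>Balls may carry arbitrary labels, later pairs of a vertex and an index. The default 0
  off \<open>I\<close> is also the number of a bin, which is why \<open>load\<close> counts only
  labels in \<open>I\<close>.\<close>

definition throws :: "'a set \<Rightarrow> nat \<Rightarrow> ('a \<Rightarrow> nat) pmf" where
  "throws I m = Pi_pmf I 0 (\<lambda>_. pmf_of_set {..<m})"

definition max_load_mean :: "nat \<Rightarrow> nat \<Rightarrow> real" where
  "max_load_mean N m = measure_pmf.expectation (max_load_pmf N m) real"

lemma top_bin:
  assumes "0 < m"
  shows "top_bin I m f < m" "load I f (top_bin I m f) = max_load I m f"
proof -
  have "max_load I m f \<in> load I f ` {..<m}"
    unfolding max_load_def by (rule Max_in) (use assms in auto)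
  then have "\<exists>b. b < m \<and> load I f b = max_load I m f" by auto
  from someI_ex[OF this] show "top_bin I m f < m" "load I f (top_bin I m f) = max_load I m f"
    unfolding top_bin_def by auto
qed

lemma load_le_max_load: "b < m \<Longrightarrow> load I f b \<le> max_load I m f"
  unfolding max_load_def by (rule Max_ge) auto

lemma max_load_mono:
  assumes "I \<subseteq> J" "finite J" "0 < m"
  shows "max_load I m f \<le> max_load J m f"
proof -
  have "max_load I m f = load I f (top_bin I m f)" using top_bin[OF assms(3)] by metis
  also have "\<dots> \<le> load J f (top_bin I m f)"
    unfolding load_def by (rule card_mono) (use assms in auto)
  also have "\<dots> \<le> max_load J m f" by (rule load_le_max_load) (use top_bin assms in auto)
  finally show ?thesis .
qed

section \<open>Exchangeability of the balls\<close>

lemma permutes_two: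
  assumes "p \<in> I" "q \<in> I" "p \<noteq> q" "p' \<in> I" "q' \<in> I" "p' \<noteq> q'"
  obtains \<pi> where "\<pi> permutes I" "\<pi> p = p'" "\<pi> q = q'"
proof
  let ?t = "Transposition.transpose p p'"
  have t: "?t permutes I" by (rule permutes_swap_id) (use assms in auto)
  have "?t q \<in> I" using t assms by (simp add: permutes_in_image)
  then have s: "Transposition.transpose (?t q) q' permutes I" by (rule permutes_swap_id) (use assms in auto)
  show "(Transposition.transpose (?t q) q' \<circ> ?t) permutes I" by (rule permutes_compose[OF t s])
  \<comment> \<open>Neither point swapped by the second transposition is \<open>p'\<close>, so it
    corrects the image of \<open>q\<close> without disturbing that of \<open>p\<close>.\<close>
  have "?t q \<noteq> p'" using assms by (metis transpose_apply_first transpose_eq_imp_eq)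
  then show "(Transposition.transpose (?t q) q' \<circ> ?t) p = p'" using assms by simp
  show "(Transposition.transpose (?t q) q' \<circ> ?t) q = q'" by simp
qed

lemma load_permute:
  assumes "\<pi> permutes I"
  shows "load I (f \<circ> \<pi>) = load I f"
proof
  fix b
  have "bij_betw \<pi> {i \<in> I. f (\<pi> i) = b} {i \<in> I. f i = b}"
  proof (rule bij_betwI[where g = "inv \<pi>"])
    show "\<pi> \<in> {i \<in> I. f (\<pi> i) = b} \<rightarrow> {i \<in> I. f i = b}"
      using assms by (auto simp: permutes_in_image)
    show "inv \<pi> \<in> {i \<in> I. f i = b} \<rightarrow> {i \<in> I. f (\<pi> i) = b}"
      using assms permutes_inv[OF assms] by (auto simp: permutes_in_image permutes_inverses)
  qed (use assms in \<open>auto simp: permutes_inverses\<close>)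
  then show "load I (f \<circ> \<pi>) b = load I f b"
    unfolding load_def using bij_betw_same_card by auto
qed

lemma max_load_permute: "\<pi> permutes I \<Longrightarrow> max_load I m (f \<circ> \<pi>) = max_load I m f"
  by (simp add: max_load_def load_permute)

lemma top_bin_permute: "\<pi> permutes I \<Longrightarrow> top_bin I m (f \<circ> \<pi>) = top_bin I m f"
  by (simp add: top_bin_def load_permute max_load_permute)

context
  fixes I :: "'a set" and m :: nat
  assumes fin [simp]: "finite I" and m [simp]: "0 < m"
begin

lemma throws_eq: "throws I m = pmf_of_set (PiE_dflt I 0 (\<lambda>_. {..<m}))"
  unfolding throws_def by (rule Pi_pmf_of_set) (use m in \<open>auto simp: lessThan_empty_iff\<close>)

lemma set_throws: "set_pmf (throws I m) = PiE_dflt I 0 (\<lambda>_. {..<m})"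
  unfolding throws_eq by (rule set_pmf_of_set) (use m in \<open>auto simp: lessThan_empty_iff\<close>)

lemma finite_throws [simp]: "finite (set_pmf (throws I m))"
  unfolding set_throws by auto

lemma throws_permute:
  assumes "\<pi> permutes I"
  shows "map_pmf (\<lambda>f. f \<circ> \<pi>) (throws I m) = throws I m"
  unfolding throws_def
  by (rule Pi_pmf_bij_betw[symmetric, OF fin permutes_imp_bij[OF assms]])
    (simp add: permutes_in_image[OF assms])

lemma expectation_permute:
  fixes F :: "_ \<Rightarrow> real"
  assumes "\<pi> permutes I"
  shows "measure_pmf.expectation (throws I m) (\<lambda>f. F (f \<circ> \<pi>))
    = measure_pmf.expectation (throws I m) F"
  using integral_map_pmf[of "\<lambda>f. f \<circ> \<pi>" "throws I m" F] by (simp only: throws_permute[OF assms])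

lemma max_load_eq_sum:
  "real (max_load I m f) = (\<Sum>i\<in>I. of_bool (f i = top_bin I m f))"
  unfolding top_bin(2)[OF m, symmetric] load_def by (rule card_eq_sum_of_bool) simp

text \<open>Transposing two balls preserves the law and the top bin, so all balls are equally likely
  to lie there; these probabilities sum to the mean maximal load.\<close>

lemma expectation_in_top_bin:
  assumes "i \<in> I"
  shows "card I * measure_pmf.expectation (throws I m) (\<lambda>f. of_bool (f i = top_bin I m f))
    = measure_pmf.expectation (throws I m) (\<lambda>f. real (max_load I m f))"
proof -
  let ?E = "measure_pmf.expectation (throws I m) :: (_ \<Rightarrow> real) \<Rightarrow> real"
  have "?E (\<lambda>f. of_bool (f j = top_bin I m f)) = ?E (\<lambda>f. of_bool (f i = top_bin I m f))"
    if "j \<in> I" for j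
  proof -
    have p: "Transposition.transpose i j permutes I" by (rule permutes_swap_id) (use assms that in auto)
    show ?thesis
      using expectation_permute[OF p, of "\<lambda>f. of_bool (f i = top_bin I m f)"]
      by (simp add: top_bin_permute[OF p])
  qed
  then show ?thesis
    unfolding max_load_eq_sum by (subst expectation_sum_finite) auto
qed

text \<open>The same symmetry for ordered pairs of distinct balls, of which the top bin contains
  \<open>M * (M - 1)\<close> for maximal load \<open>M\<close>.\<close>

lemma expectation_pair_in_top_bin:
  assumes "p \<in> I" "q \<in> I" "p \<noteq> q"
  shows "real (card I * (card I - 1)) *
      measure_pmf.expectation (throws I m) (\<lambda>f. of_bool (f p = top_bin I m f \<and> f q = top_bin I m f))
    = measure_pmf.expectation (throws I m) (\<lambda>f. real (max_load I m f * (max_load I m f - 1)))"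
proof -
  let ?E = "measure_pmf.expectation (throws I m) :: (_ \<Rightarrow> real) \<Rightarrow> real"
  let ?D = "SIGMA x:I. I - {x}"
  let ?h = "\<lambda>z f. of_bool (f (fst z) = top_bin I m f \<and> f (snd z) = top_bin I m f) :: real"
  have "?E (?h z) = ?E (?h (p, q))" if zD: "z \<in> ?D" for z
  proof -
    obtain p' q' where z: "z = (p', q')" "p' \<in> I" "q' \<in> I" "p' \<noteq> q'" using zD by (cases z) auto
    obtain \<pi> where p: "\<pi> permutes I" "\<pi> p = p'" "\<pi> q = q'"
      using permutes_two assms z(2-4) by metis
    show ?thesis
      using expectation_permute[OF p(1), of "?h (p, q)"]
      by (simp add: top_bin_permute[OF p(1)] p z)
  qed
  then have "(\<Sum>z\<in>?D. ?E (?h z)) = card ?D * ?E (?h (p, q))" by simp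
  moreover have "card ?D = card I * (card I - 1)" by (subst card_SigmaI) auto
  moreover have "(\<Sum>z\<in>?D. ?E (?h z)) = ?E (\<lambda>f. real (max_load I m f * (max_load I m f - 1)))"
  proof (subst expectation_sum_finite[symmetric], simp, rule arg_cong[where f = ?E], rule ext)
    fix f
    let ?A = "{i \<in> I. f i = top_bin I m f}"
    have "(\<Sum>z\<in>?D. ?h z f) = real (card {z \<in> ?D. f (fst z) = top_bin I m f \<and> f (snd z) = top_bin I m f})"
      by (rule card_eq_sum_of_bool[symmetric]) auto
    also have "{z \<in> ?D. f (fst z) = top_bin I m f \<and> f (snd z) = top_bin I m f}
        = (SIGMA x:?A. ?A - {x})" by auto
    also have "card \<dots> = card ?A * (card ?A - 1)" by (subst card_SigmaI) auto
    also have "card ?A = max_load I m f" using top_bin(2)[OF m, of I f] by (simp add: load_def)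
    finally show "(\<Sum>z\<in>?D. ?h z f) = real (max_load I m f * (max_load I m f - 1))" .
  qed
  ultimately show ?thesis by simp
qed

lemma prob_three_equal:
  assumes "p \<in> I" "q \<in> I" "r \<in> I" "p \<noteq> q" "p \<noteq> r" "q \<noteq> r"
  shows "measure_pmf.expectation (throws I m) (\<lambda>f. of_bool (f p = f q \<and> f q = f r)) = 1 / real m ^ 2"
proof -
  \<comment> \<open>\<open>?B b\<close> pins the three balls to bin \<open>b\<close> and leaves the
    others free, so the event splits into \<open>m\<close> disjoint product sets of probability
    \<open>1 / real m ^ 3\<close> each.\<close>
  let ?B = "\<lambda>b i. if i \<in> {p, q, r} then {b} else {..<m}"
  have "measure_pmf.expectation (throws I m) (\<lambda>f. of_bool (f p = f q \<and> f q = f r) :: real)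
      = measure_pmf.expectation (throws I m) (\<lambda>f. \<Sum>b<m. indicator (PiE_dflt I 0 (?B b)) f)"
  proof (rule expectation_cong_pmf)
    fix f assume "f \<in> set_pmf (throws I m)"
    then have f: "\<And>i. i \<in> I \<Longrightarrow> f i < m" "\<And>i. i \<notin> I \<Longrightarrow> f i = 0"
      by (auto simp: set_throws PiE_dflt_def)
    have "indicator (PiE_dflt I 0 (?B b)) f = (if b = f p then of_bool (f p = f q \<and> f q = f r) else (0::real))"
      if "b < m" for b
    proof -
      have "f \<in> PiE_dflt I 0 (?B b) \<longleftrightarrow> f p = b \<and> f q = b \<and> f r = b"
      proof
        assume "f \<in> PiE_dflt I 0 (?B b)"
        then have "f i \<in> ?B b i" if "i \<in> I" for i using that by (simp add: PiE_dflt_def)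
        from this[of p] this[of q] this[of r] show "f p = b \<and> f q = b \<and> f r = b"
          using assms by simp
      qed (use f in \<open>auto simp: PiE_dflt_def\<close>)
      then show ?thesis by (auto simp: indicator_def)
    qed
    then show "of_bool (f p = f q \<and> f q = f r) = (\<Sum>b<m. indicator (PiE_dflt I 0 (?B b)) f :: real)"
      using f(1)[OF assms(1)] by simp
  qed
  also have "\<dots> = (\<Sum>b<m. measure_pmf.prob (throws I m) (PiE_dflt I 0 (?B b)))"
    by (subst expectation_sum_finite) auto
  also have "\<dots> = (\<Sum>b<m. 1 / real m ^ 3)"
  proof (rule sum.cong[OF refl])
    fix b assume b: "b \<in> {..<m}"
    have "measure_pmf.prob (throws I m) (PiE_dflt I 0 (?B b))
        = (\<Prod>i\<in>I. measure_pmf.prob (pmf_of_set {..<m}) (?B b i))"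
      unfolding throws_def by (rule measure_Pi_pmf_PiE_dflt) simp
    also have "\<dots> = (\<Prod>i\<in>I. if i \<in> {p, q, r} then 1 / real m else 1)"
      using b by (intro prod.cong refl) (auto simp: measure_pmf_of_set lessThan_empty_iff)
    also have "\<dots> = (\<Prod>i\<in>{p, q, r}. 1 / real m)"
      using assms by (intro prod.mono_neutral_cong_right) auto
    also have "\<dots> = 1 / real m ^ 3" using assms by (simp add: power3_eq_cube)
    finally show "measure_pmf.prob (throws I m) (PiE_dflt I 0 (?B b)) = 1 / real m ^ 3" .
  qed
  also have "\<dots> = 1 / real m ^ 2" by (simp add: power2_eq_square power3_eq_cube)
  finally show ?thesis .
qed

text \<open>A union bound: the falling product counts ordered triples of distinct balls in the top
  bin, and each of the at most \<open>card I ^ 3\<close> triples shares a bin with probability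
  \<open>1 / real m ^ 2\<close>.\<close>

lemma expectation_falling_cube_le:
  "measure_pmf.expectation (throws I m)
     (\<lambda>f. real (max_load I m f * ((max_load I m f - 1) * (max_load I m f - 2)))) \<le> real (card I) ^ 3 / real m ^ 2"
proof -
  let ?E = "measure_pmf.expectation (throws I m) :: (_ \<Rightarrow> real) \<Rightarrow> real"
  let ?D = "SIGMA x:I. SIGMA y:I - {x}. I - {x, y}"
  let ?Q = "\<lambda>t f. f (fst t) = f (fst (snd t)) \<and> f (fst (snd t)) = f (snd (snd t))"
  let ?h = "\<lambda>t f. of_bool (?Q t f) :: real"
  have "?E (\<lambda>f. real (max_load I m f * ((max_load I m f - 1) * (max_load I m f - 2)))) \<le> ?E (\<lambda>f. \<Sum>t\<in>?D. ?h t f)"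
  proof (rule expectation_mono_finite)
    fix f
    let ?A = "{i \<in> I. f i = top_bin I m f}"
    have "card ?A = max_load I m f" using top_bin(2)[OF m, of I f] by (simp add: load_def)
    moreover have "card (SIGMA x:?A. SIGMA y:?A - {x}. ?A - {x, y}) = card ?A * ((card ?A - 1) * (card ?A - 2))"
    proof -
      have "card (SIGMA y:?A - {x}. ?A - {x, y}) = (card ?A - 1) * (card ?A - 2)" if "x \<in> ?A" for x
      proof -
        have "card (?A - {x, y}) = card ?A - 2" if "y \<in> ?A - {x}" for y
          using \<open>x \<in> ?A\<close> that by (subst card_Diff_subset) auto
        then have "card (SIGMA y:?A - {x}. ?A - {x, y}) = (\<Sum>y\<in>?A - {x}. card ?A - 2)"
          by (subst card_SigmaI) auto
        then show ?thesis using that by simp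
      qed
      then show ?thesis by (subst card_SigmaI) auto
    qed
    \<comment> \<open>Allowing any common bin instead of the top bin replaces a random target by an
      event of known probability.\<close>
    moreover have "card (SIGMA x:?A. SIGMA y:?A - {x}. ?A - {x, y}) \<le> card {t \<in> ?D. ?Q t f}"
      by (rule card_mono) auto
    moreover have *: "real (card {t \<in> ?D. ?Q t f}) = (\<Sum>t\<in>?D. ?h t f)"
      by (rule card_eq_sum_of_bool) auto
    ultimately have "max_load I m f * ((max_load I m f - 1) * (max_load I m f - 2))
        \<le> card {t \<in> ?D. ?Q t f}" by (simp only:)
    then have "real (max_load I m f * ((max_load I m f - 1) * (max_load I m f - 2)))
        \<le> real (card {t \<in> ?D. ?Q t f})" by (rule of_nat_mono)
    with * show "real (max_load I m f * ((max_load I m f - 1) * (max_load I m f - 2))) \<le> (\<Sum>t\<in>?D. ?h t f)"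
      by (simp only:)
  qed simp
  also have "\<dots> = (\<Sum>t\<in>?D. ?E (?h t))" by (rule expectation_sum_finite) simp
  also have "\<dots> = (\<Sum>t\<in>?D. 1 / real m ^ 2)"
  proof (rule sum.cong[OF refl])
    fix t assume "t \<in> ?D"
    then obtain x y z where "t = (x, y, z)" "x \<in> I" "y \<in> I" "z \<in> I" "x \<noteq> y" "x \<noteq> z" "y \<noteq> z"
      by (cases t) auto
    then show "?E (?h t) = 1 / real m ^ 2"
      using prob_three_equal[of x y z] by (simp only: fst_conv snd_conv simp_thms)
  qed
  also have "\<dots> = card ?D / real m ^ 2" by simp
  also have "\<dots> \<le> real (card I) ^ 3 / real m ^ 2"
  proof -
    have "?D \<subseteq> I \<times> I \<times> I" by blast
    then have "card ?D \<le> card (I \<times> I \<times> I)" by (intro card_mono finite_cartesian_product fin)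
    then have "real (card ?D) \<le> real (card I ^ 3)"
      by (simp only: card_cartesian_product power3_eq_cube mult.assoc of_nat_le_iff)
    then show ?thesis by (simp add: divide_right_mono)
  qed
  finally show ?thesis .
qed

text \<open>Only the number of balls matters: configurations are transported along a bijection of
  \<open>I\<close> with an initial segment.\<close>

lemma max_load_pmf_eq: "max_load_pmf (card I) m = map_pmf (max_load I m) (throws I m)"
proof -
  let ?N = "{..<card I}"
  obtain h0 where h0: "bij_betw h0 I ?N"
    using ex_bij_betw_finite_nat[OF fin] by (auto simp: atLeast0LessThan)
  \<comment> \<open>Labels outside \<open>I\<close> go to \<open>card I\<close>, which lies outside
    \<open>?N\<close>, so that \<open>g \<circ> h\<close> takes the default value there.\<close>
  define h where "h i = (if i \<in> I then h0 i else card I)" for i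
  have h: "bij_betw h I ?N"
    using h0 by (subst bij_betw_cong[of _ _ h0]) (auto simp: h_def)
  have "load I (g \<circ> h) = load ?N g" for g
  proof
    fix b
    have "h ` {i \<in> I. g (h i) = b} = {i \<in> ?N. g i = b}"
      using h by (auto simp: bij_betw_def)
    moreover have "inj_on h {i \<in> I. g (h i) = b}"
      by (rule inj_on_subset[OF bij_betw_imp_inj_on[OF h]]) auto
    then have "card (h ` {i \<in> I. g (h i) = b}) = card {i \<in> I. g (h i) = b}"
      by (rule card_image)
    ultimately show "load I (g \<circ> h) b = load ?N g b"
      by (simp add: load_def)
  qed
  then have "max_load I m (g \<circ> h) = max_load ?N m g" for g
    by (simp only: max_load_def)
  moreover have "throws I m = map_pmf (\<lambda>g. g \<circ> h) (throws ?N m)"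
    unfolding throws_def by (rule Pi_pmf_bij_betw) (use h in \<open>auto simp: h_def\<close>)
  moreover have "max_load_pmf (card I) m = map_pmf (max_load ?N m) (throws ?N m)"
    unfolding max_load_pmf_def throws_def max_load_def[abs_def] load_def[abs_def] ..
  ultimately show ?thesis
    by (simp only: map_pmf_comp)
qed

lemma max_load_mean_eq:
  "max_load_mean (card I) m = measure_pmf.expectation (throws I m) (\<lambda>f. real (max_load I m f))"
  by (simp add: max_load_mean_def max_load_pmf_eq)

end

section \<open>Moment bounds for the maximal load\<close>

text \<open>Truncation at \<open>2 + t\<close>: above this level \<open>k - 1\<close> and
  \<open>k - 2\<close> are at least \<open>t\<close>, so the falling cube divided by
  \<open>t ^ 2\<close> dominates \<open>k\<close>. The parameter \<open>t\<close> is chosen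
  later.\<close>

lemma max_load_mean_le:
  assumes "0 < m" "0 < t"
  shows "max_load_mean N m \<le> 2 + t + real N ^ 3 / (real m ^ 2 * t ^ 2)"
proof -
  let ?M = "max_load {..<N} m"
  let ?E = "measure_pmf.expectation (throws {..<N} m) :: (_ \<Rightarrow> real) \<Rightarrow> real"
  let ?F = "\<lambda>f. real (?M f * ((?M f - 1) * (?M f - 2)))"
  have "real k \<le> 2 + t + real (k * ((k - 1) * (k - 2))) / t ^ 2" for k
  proof (cases "real k \<le> 2 + t")
    case True
    then show ?thesis by (simp add: add_increasing2)
  next
    case False
    then have k: "t \<le> real (k - 1)" "t \<le> real (k - 2)" using assms by (auto simp: of_nat_diff)
    then have "t ^ 2 \<le> real ((k - 1) * (k - 2))"
      using assms by (simp add: power2_eq_square mult_mono)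
    then have "real k * t ^ 2 \<le> real (k * ((k - 1) * (k - 2)))"
      by (simp only: of_nat_mult[of k]) (rule mult_left_mono, auto)
    then show ?thesis using assms by (simp add: field_simps add_increasing)
  qed
  then have "?E (\<lambda>f. real (?M f)) \<le> ?E (\<lambda>f. 2 + t + ?F f / t ^ 2)"
    using assms by (intro expectation_mono_finite) auto
  also have "\<dots> = 2 + t + ?E ?F / t ^ 2"
    using assms by (simp add: integrable_measure_pmf_finite)
  also have "\<dots> \<le> 2 + t + (real N ^ 3 / real m ^ 2) / t ^ 2"
    using expectation_falling_cube_le[of "{..<N}" m] assms
    by (intro add_left_mono divide_right_mono) auto
  finally show ?thesis
    using max_load_mean_eq[of "{..<N}" m] assms by (simp add: mult.commute)
qed

definition max_load_pairs_mean :: "nat \<Rightarrow> nat \<Rightarrow> real" where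
  "max_load_pairs_mean N m = measure_pmf.expectation (max_load_pmf N m) (\<lambda>k. real (k * (k - 1)))"

text \<open>The same truncation; here only the factor \<open>k - 2\<close> of the cube is surplus,
  which gives a single division by \<open>t\<close>.\<close>

lemma max_load_pairs_mean_le:
  assumes "0 < m" "0 < t"
  shows "max_load_pairs_mean N m \<le> (2 + t) ^ 2 + real N ^ 3 / (real m ^ 2 * t)"
proof -
  let ?M = "max_load {..<N} m"
  let ?E = "measure_pmf.expectation (throws {..<N} m) :: (_ \<Rightarrow> real) \<Rightarrow> real"
  let ?F = "\<lambda>f. real (?M f * ((?M f - 1) * (?M f - 2)))"
  have "real (k * (k - 1)) \<le> (2 + t) ^ 2 + real (k * ((k - 1) * (k - 2))) / t" for k
  proof (cases "real k \<le> 2 + t")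
    case True
    then have "real k * real (k - 1) \<le> (2 + t) * (2 + t)"
      using assms by (intro mult_mono) auto
    moreover have "0 \<le> real (k * ((k - 1) * (k - 2))) / t" using assms by simp
    ultimately show ?thesis by (simp add: power2_eq_square)
  next
    case False
    then have k: "t \<le> real (k - 2)" using assms by (auto simp: of_nat_diff)
    then have "real (k * (k - 1)) * t \<le> real (k * (k - 1)) * real (k - 2)"
      by (rule mult_left_mono) simp
    then have "real (k * (k - 1)) \<le> real (k * ((k - 1) * (k - 2))) / t"
      using assms by (simp add: pos_le_divide_eq mult.assoc)
    then show ?thesis by (simp add: add_increasing)
  qed
  then have "?E (\<lambda>f. real (?M f * (?M f - 1))) \<le> ?E (\<lambda>f. (2 + t) ^ 2 + ?F f / t)"
    using assms by (intro expectation_mono_finite finite_throws) (auto simp del: of_nat_mult)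
  also have "\<dots> = (2 + t) ^ 2 + ?E ?F / t"
    using assms by (simp add: integrable_measure_pmf_finite del: of_nat_mult)
  also have "\<dots> \<le> (2 + t) ^ 2 + (real N ^ 3 / real m ^ 2) / t"
    using expectation_falling_cube_le[of "{..<N}" m] assms
    by (intro add_left_mono divide_right_mono) auto
  finally show ?thesis
    using max_load_pmf_eq[of "{..<N}" m] assms
    by (simp add: max_load_pairs_mean_def mult.commute)
qed

text \<open>The first \<open>T\<close> of the \<open>N\<close> balls put on average a proportion \<open>T / N\<close> of the maximal load into the
  top bin of all \<open>N\<close> balls, by exchangeability.\<close>
lemma dTV_max_load_le:
  assumes "0 < m" "T \<le> N" "0 < N"
  shows "dTV (max_load_pmf T m) (max_load_pmf N m) \<le> real (N - T) * max_load_mean N m / real N"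
proof -
  let ?p = "throws {..<N} m"
  let ?E = "measure_pmf.expectation ?p :: (_ \<Rightarrow> real) \<Rightarrow> real"
  let ?L = "max_load {..<T} m" and ?M = "max_load {..<N} m" and ?t = "top_bin {..<N} m"
  have fin: "finite (set_pmf ?p)" using assms by simp
  have int: "integrable ?p f" for f :: "_ \<Rightarrow> real"
    by (rule integrable_measure_pmf_finite[OF fin])
  \<comment> \<open>Both maximal loads are read off the same throw of \<open>N\<close> balls:
    forgetting the balls from \<open>T\<close> on leaves a throw of \<open>T\<close> balls.\<close>
  have "throws {..<T} m = map_pmf (\<lambda>f i. if i \<in> {..<T} then f i else 0) ?p"
    unfolding throws_def by (rule Pi_pmf_subset) (use assms in auto)
  moreover have "load {..<T} (\<lambda>i. if i \<in> {..<T} then f i else 0) = load {..<T} f" for f :: "nat \<Rightarrow> nat"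
    by (rule ext) (auto simp: load_def intro!: arg_cong[where f = card])
  ultimately have T: "max_load_pmf T m = map_pmf ?L ?p"
    using max_load_pmf_eq[of "{..<T}" m] assms by (simp add: map_pmf_comp max_load_def[abs_def])
  have N: "max_load_pmf N m = map_pmf ?M ?p"
    using max_load_pmf_eq[of "{..<N}" m] assms by simp
  have EM: "max_load_mean N m = ?E (\<lambda>f. real (?M f))"
    using max_load_mean_eq[of "{..<N}" m] assms by simp
  have "dTV (max_load_pmf T m) (max_load_pmf N m) \<le> ?E (\<lambda>f. \<bar>real (?L f) - real (?M f)\<bar>)"
    unfolding T N by (rule dTV_map_le[OF fin])
  also have "\<dots> = ?E (\<lambda>f. real (?M f) - real (?L f))"
    using max_load_mono[of "{..<T}" "{..<N}" m] assms
    by (intro expectation_cong_pmf) (simp add: abs_of_nonpos)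
  also have "\<dots> = max_load_mean N m - ?E (\<lambda>f. real (?L f))"
    unfolding EM by (rule Bochner_Integration.integral_diff) (rule int)+
  also have "?E (\<lambda>f. real (?L f)) \<ge> ?E (\<lambda>f. \<Sum>i<T. of_bool (f i = ?t f))"
  proof (rule expectation_mono_finite[OF fin])
    fix f
    have "(\<Sum>i<T. of_bool (f i = ?t f)) = real (load {..<T} f (?t f))"
      unfolding load_def by (rule card_eq_sum_of_bool[symmetric]) simp
    also have "\<dots> \<le> real (?L f)"
      using load_le_max_load[OF top_bin(1)] assms by simp
    finally show "(\<Sum>i<T. of_bool (f i = ?t f)) \<le> real (?L f)" .
  qed
  moreover have "?E (\<lambda>f. \<Sum>i<T. of_bool (f i = ?t f)) = (\<Sum>i<T. ?E (\<lambda>f. of_bool (f i = ?t f)))"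
    by (rule expectation_sum_finite[OF fin])
  moreover have "\<dots> = (\<Sum>i<T. max_load_mean N m / real N)"
  proof (rule sum.cong[OF refl])
    fix i assume "i \<in> {..<T}"
    then have "real N * ?E (\<lambda>f. of_bool (f i = ?t f)) = max_load_mean N m"
      unfolding EM using expectation_in_top_bin[of "{..<N}" m i] assms by simp
    then show "?E (\<lambda>f. of_bool (f i = ?t f)) = max_load_mean N m / real N"
      using assms by (simp add: eq_divide_eq mult.commute)
  qed
  moreover have "real (N - T) * max_load_mean N m / real N
      = max_load_mean N m - real T * (max_load_mean N m / real N)"
    using assms by (simp add: of_nat_diff field_simps)
  ultimately show ?thesis by simp
qed

subsection \<open>Coupling attribute sets with balls\<close>

text \<open>A bijection from \<open>A\<close> to \<open>B\<close> and one between the complements in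
  \<open>W\<close>, which have equal size, are glued and extended by the identity.\<close>

lemma ex_permutes_image:
  assumes "finite W" "A \<subseteq> W" "B \<subseteq> W" "card A = card B"
  obtains \<sigma> where "\<sigma> permutes W" "\<sigma> ` A = B"
proof -
  have fin: "finite A" "finite B" using assms finite_subset by auto
  obtain f where f: "bij_betw f A B"
    using finite_same_card_bij[OF fin assms(4)] by auto
  have "card (W - A) = card (W - B)"
    using assms fin by (simp add: card_Diff_subset)
  then obtain g where g: "bij_betw g (W - A) (W - B)"
    using finite_same_card_bij[of "W - A" "W - B"] assms(1) by auto
  define h where "h x = (if x \<in> A then f x else if x \<in> W then g x else x)" for x
  have hA: "bij_betw h A B"
    using f by (subst bij_betw_cong[of _ _ f]) (auto simp: h_def)
  have "bij_betw h (W - A) (W - B)"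
    using g by (subst bij_betw_cong[of _ _ g]) (auto simp: h_def)
  from bij_betw_combine[OF hA this] have "bij_betw h W W"
    using assms by (simp add: Un_absorb1)
  then have "h permutes W"
    by (rule bij_imp_permutes) (use assms in \<open>auto simp: h_def\<close>)
  moreover have "h ` A = B" using hA by (simp add: bij_betw_def)
  ultimately show ?thesis using that by blast
qed

lemma pmf_eq_pmf_of_set:
  assumes "finite A" "set_pmf p \<subseteq> A" "\<And>x y. x \<in> A \<Longrightarrow> y \<in> A \<Longrightarrow> pmf p x = pmf p y"
  shows "p = pmf_of_set A"
proof -
  have ne: "A \<noteq> {}" using assms(2) set_pmf_not_empty[of p] by auto
  have "pmf p x = pmf (pmf_of_set A) x" for x
  proof (cases "x \<in> A")
    case True
    have "1 = (\<Sum>y\<in>A. pmf p y)" using sum_pmf_eq_1[OF assms(1,2)] by simp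
    also have "\<dots> = (\<Sum>y\<in>A. pmf p x)" by (rule sum.cong[OF refl], rule assms(3)) (use True in auto)
    finally have "card A * pmf p x = 1" by simp
    moreover have "card A \<noteq> 0" using assms(1) ne by simp
    ultimately show ?thesis using True assms(1) ne by (simp add: field_simps)
  next
    case False
    then show ?thesis using assms(1,2) ne by (auto simp: pmf_eq_0_set_pmf)
  qed
  then show ?thesis by (rule pmf_eqI)
qed

text \<open>The labels of the balls: \<open>(v, i)\<close> is ball number \<open>i\<close> of vertex
  \<open>v\<close>.\<close>

definition slots :: "nat \<Rightarrow> (nat \<Rightarrow> nat) \<Rightarrow> (nat \<times> nat) set" where
  "slots n x = (SIGMA v:{..<n}. {..<x v})"

text \<open>The empty default off \<open>{..<n}\<close> agrees with \<open>attr_sets_pmf\<close>, so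
  that the uniform law on this set is the conditional law of the attribute sets given their
  sizes.\<close>

definition set_families :: "nat \<Rightarrow> nat \<Rightarrow> (nat \<Rightarrow> nat) \<Rightarrow> (nat \<Rightarrow> nat set) set" where
  "set_families n m x = PiE_dflt {..<n} {} (\<lambda>v. {S. S \<subseteq> {..<m} \<and> card S = x v})"

definition compatible :: "nat \<Rightarrow> nat \<Rightarrow> (nat \<Rightarrow> nat) \<Rightarrow> (nat \<times> nat \<Rightarrow> nat) \<Rightarrow> (nat \<Rightarrow> nat set) set" where
  "compatible n m x b = {S \<in> set_families n m x. \<forall>(v, i) \<in> slots n x. b (v, i) \<in> S v}"

text \<open>The balls have the right law by construction; that the sets are again uniform follows by
  symmetry in \<open>coupling_sets\<close>.\<close>

definition coupling :: "nat \<Rightarrow> nat \<Rightarrow> (nat \<Rightarrow> nat) \<Rightarrow> ((nat \<times> nat \<Rightarrow> nat) \<times> (nat \<Rightarrow> nat set)) pmf" where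
  "coupling n m x = do {b \<leftarrow> throws (slots n x) m; S \<leftarrow> pmf_of_set (compatible n m x b); return_pmf (b, S)}"

definition distinct_load :: "nat \<Rightarrow> (nat \<Rightarrow> nat) \<Rightarrow> (nat \<times> nat \<Rightarrow> nat) \<Rightarrow> nat \<Rightarrow> nat" where
  "distinct_load n x b w = card {v \<in> {..<n}. \<exists>i<x v. b (v, i) = w}"

text \<open>Each vertex has its own permutation of the bins. The value 0 off the slots keeps the
  result a configuration of \<open>throws\<close>.\<close>

definition relabel_balls :: "nat \<Rightarrow> (nat \<Rightarrow> nat) \<Rightarrow> (nat \<Rightarrow> nat \<Rightarrow> nat) \<Rightarrow> (nat \<times> nat \<Rightarrow> nat) \<Rightarrow> (nat \<times> nat \<Rightarrow> nat)" where
  "relabel_balls n x \<sigma> b = (\<lambda>z. if z \<in> slots n x then \<sigma> (fst z) (b z) else 0)"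

definition relabel_sets :: "(nat \<Rightarrow> nat \<Rightarrow> nat) \<Rightarrow> (nat \<Rightarrow> nat set) \<Rightarrow> (nat \<Rightarrow> nat set)" where
  "relabel_sets \<sigma> S = (\<lambda>v. \<sigma> v ` S v)"

context
  fixes n m :: nat and x :: "nat \<Rightarrow> nat"
  assumes m [simp]: "0 < m" and x: "\<And>v. v < n \<Longrightarrow> x v \<le> m"
begin

lemma finite_slots [simp]: "finite (slots n x)"
  by (simp add: slots_def)

lemma card_slots: "card (slots n x) = (\<Sum>v<n. x v)"
  by (simp add: slots_def)

lemma finite_set_families [simp]: "finite (set_families n m x)"
  unfolding set_families_def by (rule finite_PiE_dflt) auto

lemma finite_compatible [simp]: "finite (compatible n m x b)"
  unfolding compatible_def by simp

text \<open>\<open>pmf_of_set\<close> is meaningful only on nonempty sets. The balls of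
  \<open>v\<close> hit at most \<open>x v\<close> bins, and \<open>x v \<le> m\<close> leaves room
  to enlarge these to exactly \<open>x v\<close>.\<close>

lemma compatible_nonempty:
  assumes "b \<in> set_pmf (throws (slots n x) m)"
  shows "compatible n m x b \<noteq> {}"
proof -
  have "\<exists>S. (\<lambda>i. b (v, i)) ` {..<x v} \<subseteq> S \<and> S \<subseteq> {..<m} \<and> card S = x v" if "v < n" for v
  proof -
    have "(\<lambda>i. b (v, i)) ` {..<x v} \<subseteq> {..<m}"
      using assms that by (auto simp: set_throws PiE_dflt_def slots_def)
    moreover have "card ((\<lambda>i. b (v, i)) ` {..<x v}) \<le> x v"
      using card_image_le[of "{..<x v}"] by simp
    ultimately show ?thesis
      using exists_subset_between[of _ "x v" "{..<m}"] x[OF that] by fastforce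
  qed
  then obtain S where S: "\<And>v. v < n \<Longrightarrow> (\<lambda>i. b (v, i)) ` {..<x v} \<subseteq> S v \<and> S v \<subseteq> {..<m} \<and> card (S v) = x v"
    by metis
  have "(\<lambda>v. if v < n then S v else {}) \<in> compatible n m x b"
    using S by (auto simp: compatible_def set_families_def PiE_dflt_def slots_def)
  then show ?thesis by blast
qed

lemma set_coupling:
  assumes "(b, S) \<in> set_pmf (coupling n m x)"
  shows "b \<in> set_pmf (throws (slots n x) m)" "S \<in> compatible n m x b" "S \<in> set_families n m x"
proof -
  show b: "b \<in> set_pmf (throws (slots n x) m)"
    using assms by (auto simp: coupling_def)
  show "S \<in> compatible n m x b"
    using assms compatible_nonempty by (auto simp: coupling_def)
  then show "S \<in> set_families n m x" by (simp add: compatible_def)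
qed

lemma finite_coupling [simp]: "finite (set_pmf (coupling n m x))"
proof (rule finite_subset)
  show "set_pmf (coupling n m x) \<subseteq> set_pmf (throws (slots n x) m) \<times> set_families n m x"
    using set_coupling by auto
qed simp

lemma coupling_balls: "map_pmf fst (coupling n m x) = throws (slots n x) m"
  by (simp add: coupling_def map_bind_pmf bind_return_pmf')

section \<open>Symmetry of the coupling under relabelling the bins\<close>

lemma relabel_sets_in_set_families:
  assumes \<sigma>: "\<And>v. \<sigma> v permutes {..<m}" and "S \<in> set_families n m x"
  shows "relabel_sets \<sigma> S \<in> set_families n m x"
proof -
  have "\<sigma> v ` S v \<subseteq> {..<m} \<and> card (\<sigma> v ` S v) = x v" if "v < n" for v
  proof -
    have S: "S v \<subseteq> {..<m}" "card (S v) = x v"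
      using assms(2) that by (auto simp: set_families_def PiE_dflt_def)
    have "card (\<sigma> v ` S v) = card (S v)"
      by (rule card_image[OF inj_on_subset[OF permutes_inj[OF \<sigma>] subset_UNIV]])
    moreover have "\<sigma> v ` S v \<subseteq> \<sigma> v ` {..<m}" using S(1) by (rule image_mono)
    ultimately show ?thesis using S by (simp add: permutes_image[OF \<sigma>])
  qed
  then show ?thesis
    using assms(2) by (simp add: set_families_def PiE_dflt_def relabel_sets_def)
qed

lemma relabel_sets_in_compatible:
  assumes \<sigma>: "\<And>v. \<sigma> v permutes {..<m}" and "S \<in> compatible n m x b"
  shows "relabel_sets \<sigma> S \<in> compatible n m x (relabel_balls n x \<sigma> b)"
  using assms(2) relabel_sets_in_set_families[OF \<sigma>, where S = S]
  by (auto simp: compatible_def relabel_sets_def relabel_balls_def)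

lemma relabel_sets_inverse:
  assumes \<sigma>: "\<And>v. \<sigma> v permutes {..<m}"
  shows "relabel_sets (\<lambda>v. inv (\<sigma> v)) (relabel_sets \<sigma> S) = S"
    "relabel_sets \<sigma> (relabel_sets (\<lambda>v. inv (\<sigma> v)) S) = S"
  using permutes_inverses[OF \<sigma>] by (simp_all add: relabel_sets_def image_image)

lemma relabel_balls_inverse:
  assumes \<sigma>: "\<And>v. \<sigma> v permutes {..<m}" and "b \<in> set_pmf (throws (slots n x) m)"
  shows "relabel_balls n x (\<lambda>v. inv (\<sigma> v)) (relabel_balls n x \<sigma> b) = b"
    "relabel_balls n x \<sigma> (relabel_balls n x (\<lambda>v. inv (\<sigma> v)) b) = b"
  using permutes_inverses[OF \<sigma>] assms(2)
  by (auto simp: relabel_balls_def set_throws PiE_dflt_def fun_eq_iff)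

lemma relabel_balls_in_throws:
  assumes \<sigma>: "\<And>v. \<sigma> v permutes {..<m}" and "b \<in> set_pmf (throws (slots n x) m)"
  shows "relabel_balls n x \<sigma> b \<in> set_pmf (throws (slots n x) m)"
  using assms(2) permutes_in_image[OF \<sigma>]
  by (auto simp: relabel_balls_def set_throws PiE_dflt_def)

lemma map_relabel_balls_throws:
  assumes \<sigma>: "\<And>v. \<sigma> v permutes {..<m}"
  shows "map_pmf (relabel_balls n x \<sigma>) (throws (slots n x) m) = throws (slots n x) m"
proof -
  let ?A = "set_pmf (throws (slots n x) m)"
  have U: "throws (slots n x) m = pmf_of_set ?A"
    using throws_eq[of "slots n x" m] set_throws[of "slots n x" m] by simp
  have \<sigma>': "inv (\<sigma> v) permutes {..<m}" for v by (rule permutes_inv[OF \<sigma>])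
  have "bij_betw (relabel_balls n x \<sigma>) ?A ?A"
    by (rule bij_betwI[where g = "relabel_balls n x (\<lambda>v. inv (\<sigma> v))"])
      (use relabel_balls_in_throws[OF \<sigma>] relabel_balls_in_throws[OF \<sigma>'] relabel_balls_inverse[OF \<sigma>] in auto)
  then have "map_pmf (relabel_balls n x \<sigma>) (pmf_of_set ?A) = pmf_of_set ?A"
    by (rule map_pmf_of_set_bij_betw) (simp_all add: set_pmf_not_empty)
  then show ?thesis using U by simp
qed

text \<open>Relabelling is a bijection between the two sets of compatible families, with the inverse
  permutations as inverse, and so preserves uniformity.\<close>

lemma map_relabel_sets_compatible:
  assumes \<sigma>: "\<And>v. \<sigma> v permutes {..<m}" and b: "b \<in> set_pmf (throws (slots n x) m)"
  shows "map_pmf (relabel_sets \<sigma>) (pmf_of_set (compatible n m x b))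
    = pmf_of_set (compatible n m x (relabel_balls n x \<sigma> b))"
proof (rule map_pmf_of_set_bij_betw)
  have \<sigma>': "inv (\<sigma> v) permutes {..<m}" for v by (rule permutes_inv[OF \<sigma>])
  show "bij_betw (relabel_sets \<sigma>) (compatible n m x b) (compatible n m x (relabel_balls n x \<sigma> b))"
  proof (rule bij_betwI[where g = "relabel_sets (\<lambda>v. inv (\<sigma> v))"])
    show "relabel_sets (\<lambda>v. inv (\<sigma> v)) \<in> compatible n m x (relabel_balls n x \<sigma> b) \<rightarrow> compatible n m x b"
    proof (rule funcsetI)
      fix S assume "S \<in> compatible n m x (relabel_balls n x \<sigma> b)"
      from relabel_sets_in_compatible[where \<sigma> = "\<lambda>v. inv (\<sigma> v)", OF \<sigma>' this]
      show "relabel_sets (\<lambda>v. inv (\<sigma> v)) S \<in> compatible n m x b"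
        by (simp add: relabel_balls_inverse[OF \<sigma> b])
    qed
  qed (use relabel_sets_in_compatible[OF \<sigma>] relabel_sets_inverse[OF \<sigma>] in auto)
qed (simp_all add: compatible_nonempty b)

text \<open>Both stages of the experiment respect relabelling: the balls because their law is
  uniform, the sets given the balls by \<open>map_relabel_sets_compatible\<close>.\<close>

lemma map_relabel_coupling:
  assumes \<sigma>: "\<And>v. \<sigma> v permutes {..<m}"
  shows "map_pmf (map_prod (relabel_balls n x \<sigma>) (relabel_sets \<sigma>)) (coupling n m x) = coupling n m x"
proof -
  let ?B = "throws (slots n x) m"
  have c: "coupling n m x = bind_pmf ?B (\<lambda>b. map_pmf (Pair b) (pmf_of_set (compatible n m x b)))"
    by (simp add: coupling_def map_pmf_def)
  have "map_pmf (map_prod (relabel_balls n x \<sigma>) (relabel_sets \<sigma>)) (coupling n m x)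
    = bind_pmf ?B (\<lambda>b. map_pmf (Pair (relabel_balls n x \<sigma> b)) (map_pmf (relabel_sets \<sigma>) (pmf_of_set (compatible n m x b))))"
    by (simp add: c map_bind_pmf map_pmf_comp)
  also have "\<dots> = bind_pmf ?B (\<lambda>b. map_pmf (Pair (relabel_balls n x \<sigma> b)) (pmf_of_set (compatible n m x (relabel_balls n x \<sigma> b))))"
    by (rule bind_pmf_cong[OF refl]) (simp add: map_relabel_sets_compatible[OF \<sigma>])
  also have "\<dots> = bind_pmf (map_pmf (relabel_balls n x \<sigma>) ?B) (\<lambda>b. map_pmf (Pair b) (pmf_of_set (compatible n m x b)))"
    by (simp add: bind_map_pmf)
  also have "\<dots> = coupling n m x"
    by (simp add: map_relabel_balls_throws[OF \<sigma>] c)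
  finally show ?thesis .
qed

text \<open>One permutation of the bins per vertex carries any family to any other, and the coupling
  is invariant under such relabellings; hence all families are equally likely.\<close>

lemma coupling_sets: "map_pmf snd (coupling n m x) = pmf_of_set (set_families n m x)"
proof (rule pmf_eq_pmf_of_set)
  show "set_pmf (map_pmf snd (coupling n m x)) \<subseteq> set_families n m x"
    using set_coupling by auto
  fix S S' assume S: "S \<in> set_families n m x" "S' \<in> set_families n m x"
  have "\<exists>\<sigma>. \<sigma> permutes {..<m} \<and> \<sigma> ` S v = S' v" for v
  proof (rule ex_permutes_image[of "{..<m}" "S v" "S' v"])
    show "S v \<subseteq> {..<m}" "S' v \<subseteq> {..<m}" "card (S v) = card (S' v)"
      using S by (cases "v < n"; auto simp: set_families_def PiE_dflt_def)+
  qed auto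
  then obtain \<sigma> where \<sigma>: "\<And>v. \<sigma> v permutes {..<m}" "\<And>v. \<sigma> v ` S v = S' v" by metis
  have "inj (relabel_sets \<sigma>)"
    by (rule inj_on_inverseI[of UNIV "relabel_sets (\<lambda>v. inv (\<sigma> v))"])
      (simp add: relabel_sets_inverse(1)[OF \<sigma>(1)])
  moreover have "map_pmf (relabel_sets \<sigma>) (map_pmf snd (coupling n m x)) = map_pmf snd (coupling n m x)"
  proof -
    have "map_pmf (relabel_sets \<sigma>) (map_pmf snd (coupling n m x))
        = map_pmf snd (map_pmf (map_prod (relabel_balls n x \<sigma>) (relabel_sets \<sigma>)) (coupling n m x))"
      by (simp add: map_pmf_comp)
    then show ?thesis by (simp only: map_relabel_coupling[OF \<sigma>(1)])
  qed
  moreover have "relabel_sets \<sigma> S = S'" using \<sigma>(2) by (simp add: relabel_sets_def)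
  ultimately show "pmf (map_pmf snd (coupling n m x)) S = pmf (map_pmf snd (coupling n m x)) S'"
    using pmf_map_inj'[of "relabel_sets \<sigma>" "map_pmf snd (coupling n m x)" S] by simp
qed simp

text \<open>The coupling is invariant under transpositions of two elements of \<open>S v\<close>.\<close>
lemma coupling_ball_uniform:
  assumes vi: "(v, i) \<in> slots n x" and S: "S \<in> set_families n m x" and w: "w \<in> S v"
  shows "real (x v) * measure_pmf.expectation (coupling n m x) (\<lambda>z. of_bool (snd z = S \<and> fst z (v, i) = w))
    = measure_pmf.expectation (coupling n m x) (\<lambda>z. of_bool (snd z = S))"
proof -
  let ?E = "measure_pmf.expectation (coupling n m x) :: (_ \<Rightarrow> real) \<Rightarrow> real"
  let ?F = "\<lambda>w z. of_bool (snd z = S \<and> fst z (v, i) = w) :: real"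
  have Sv: "S v \<subseteq> {..<m}" "card (S v) = x v"
    using S vi by (auto simp: set_families_def PiE_dflt_def slots_def)
  have "?E (?F w') = ?E (?F w)" if w': "w' \<in> S v" for w'
  proof -
    \<comment> \<open>Only vertex \<open>v\<close> is affected. As \<open>w\<close> and
      \<open>w'\<close> both lie in \<open>S v\<close>, the family \<open>S\<close> is fixed while
      the two positions of the ball are exchanged.\<close>
    define \<sigma> where "\<sigma> u = (if u = v then Transposition.transpose w w' else id)" for u
    have \<sigma>: "\<sigma> u permutes {..<m}" for u
      using Sv(1) w w' by (auto simp: \<sigma>_def permutes_id intro!: permutes_swap_id)
    have fixS: "relabel_sets \<sigma> S = S"
      using w w' by (auto simp: relabel_sets_def \<sigma>_def fun_eq_iff)
    have "relabel_sets \<sigma> S' = S \<longleftrightarrow> S' = S" for S'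
    proof
      assume "relabel_sets \<sigma> S' = S"
      then have "relabel_sets \<sigma> S' = relabel_sets \<sigma> S" by (simp only: fixS)
      from arg_cong[where f = "relabel_sets (\<lambda>v. inv (\<sigma> v))", OF this] show "S' = S"
        by (simp only: relabel_sets_inverse(1)[OF \<sigma>])
    qed (simp only: fixS)
    moreover have "relabel_balls n x \<sigma> b (v, i) = w \<longleftrightarrow> b (v, i) = w'" for b
      using vi by (auto simp: relabel_balls_def \<sigma>_def transpose_eq_iff)
    ultimately have "?F w (map_prod (relabel_balls n x \<sigma>) (relabel_sets \<sigma>) z) = ?F w' z" for z
      by (cases z) simp
    then show ?thesis
      using integral_map_pmf[of "map_prod (relabel_balls n x \<sigma>) (relabel_sets \<sigma>)" "coupling n m x" "?F w"]
      by (simp only: map_relabel_coupling[OF \<sigma>])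
  qed
  \<comment> \<open>Compatibility forces the ball into \<open>S v\<close>, so these equal
    probabilities exhaust the event that the sets are \<open>S\<close>.\<close>
  then have "real (x v) * ?E (?F w) = (\<Sum>w'\<in>S v. ?E (?F w'))"
    using Sv by simp
  also have "\<dots> = ?E (\<lambda>z. \<Sum>w'\<in>S v. ?F w' z)"
    by (rule expectation_sum_finite[symmetric]) simp
  also have "\<dots> = ?E (\<lambda>z. of_bool (snd z = S))"
  proof (rule expectation_cong_pmf)
    fix z assume "z \<in> set_pmf (coupling n m x)"
    then have "snd z \<in> compatible n m x (fst z)"
      using set_coupling(2) by (cases z) auto
    then have "snd z = S \<Longrightarrow> fst z (v, i) \<in> S v"
      using vi by (auto simp: compatible_def)
    moreover have "finite (S v)" using Sv(1) finite_subset by blast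
    ultimately show "(\<Sum>w'\<in>S v. ?F w' z) = of_bool (snd z = S)"
      by (cases "snd z = S") (simp_all add: of_bool_def)
  qed
  finally show ?thesis .
qed

text \<open>As \<open>\<beta>\<close> looks only at the sets, it is constant once they are fixed;
  the ball then hits that bin with probability \<open>1 / x v\<close> if it belongs to
  \<open>S v\<close>, and never otherwise.\<close>

lemma coupling_ball_in_selected_bin:
  assumes vi: "(v, i) \<in> slots n x"
  shows "real (x v) * measure_pmf.expectation (coupling n m x) (\<lambda>z. of_bool (fst z (v, i) = \<beta> (snd z)))
    = measure_pmf.expectation (coupling n m x) (\<lambda>z. of_bool (\<beta> (snd z) \<in> snd z v))"
proof -
  let ?E = "measure_pmf.expectation (coupling n m x) :: (_ \<Rightarrow> real) \<Rightarrow> real"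
  let ?SS = "set_families n m x"
  have dec: "?E (\<lambda>z. of_bool (Q z)) = (\<Sum>S\<in>?SS. ?E (\<lambda>z. of_bool (snd z = S \<and> Q z)))" for Q
  proof -
    have "?E (\<lambda>z. of_bool (Q z)) = ?E (\<lambda>z. \<Sum>S\<in>?SS. of_bool (snd z = S \<and> Q z))"
    proof (rule expectation_cong_pmf)
      fix z assume "z \<in> set_pmf (coupling n m x)"
      then have "snd z \<in> ?SS" using set_coupling(3) by (cases z) auto
      then show "of_bool (Q z) = (\<Sum>S\<in>?SS. of_bool (snd z = S \<and> Q z) :: real)"
        by (cases "Q z") (simp_all add: of_bool_def)
    qed
    also have "\<dots> = (\<Sum>S\<in>?SS. ?E (\<lambda>z. of_bool (snd z = S \<and> Q z)))"
      by (rule expectation_sum_finite) simp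
    finally show ?thesis .
  qed
  have "real (x v) * ?E (\<lambda>z. of_bool (snd z = S \<and> fst z (v, i) = \<beta> (snd z)))
      = ?E (\<lambda>z. of_bool (snd z = S \<and> \<beta> (snd z) \<in> snd z v))" if S: "S \<in> ?SS" for S
  proof (cases "\<beta> S \<in> S v")
    case True
    have "(\<lambda>z. of_bool (snd z = S \<and> fst z (v, i) = \<beta> (snd z))) = (\<lambda>z. of_bool (snd z = S \<and> fst z (v, i) = \<beta> S) :: real)"
      by (rule ext) auto
    moreover have "?E (\<lambda>z. of_bool (snd z = S \<and> \<beta> (snd z) \<in> snd z v)) = ?E (\<lambda>z. of_bool (snd z = S))"
      using True by (intro arg_cong[where f = ?E] ext) auto
    ultimately show ?thesis using coupling_ball_uniform[OF vi S True] by (simp only:)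
  next
    case False
    have "?E (\<lambda>z. of_bool (snd z = S \<and> fst z (v, i) = \<beta> (snd z))) = ?E (\<lambda>z. 0)"
    proof (rule expectation_cong_pmf)
      fix z assume "z \<in> set_pmf (coupling n m x)"
      then have "snd z \<in> compatible n m x (fst z)" using set_coupling(2) by (cases z) auto
      then have "fst z (v, i) \<in> snd z v" using vi by (auto simp: compatible_def)
      then show "of_bool (snd z = S \<and> fst z (v, i) = \<beta> (snd z)) = (0::real)"
        using False by auto
    qed
    moreover have "?E (\<lambda>z. of_bool (snd z = S \<and> \<beta> (snd z) \<in> snd z v)) = ?E (\<lambda>z. 0)"
      using False by (intro arg_cong[where f = ?E] ext) auto
    ultimately show ?thesis by simp
  qed
  then show ?thesis
    by (subst (1 2) dec) (simp add: sum_distrib_left)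
qed

section \<open>Comparison of \<open>omega'\<close> with the maximal load\<close>

lemma load_slots: "load (slots n x) b w = (\<Sum>v<n. card {i \<in> {..<x v}. b (v, i) = w})"
proof -
  have "{z \<in> slots n x. b z = w} = (SIGMA v:{..<n}. {i \<in> {..<x v}. b (v, i) = w})"
    by (auto simp: slots_def)
  then show ?thesis by (simp add: load_def)
qed

lemma omega'_attained:
  obtains w where "w < m" "omega' n m S = card {v \<in> {..<n}. w \<in> S v}"
proof -
  have "omega' n m S \<in> (\<lambda>w. card {v \<in> {..<n}. w \<in> S v}) ` {..<m}"
    unfolding omega'_def by (rule Max_in) (use m in \<open>auto simp: lessThan_empty_iff\<close>)
  then show ?thesis using that by auto
qed

text \<open>Let \<open>\<beta>\<close> select an attribute attaining \<open>omega'\<close>. Each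
  vertex owning it places one ball there on average, so the mean load of this bin is the mean of
  \<open>omega'\<close>, and the maximal load is at least as large.\<close>

lemma expectation_omega'_le:
  "measure_pmf.expectation (coupling n m x) (\<lambda>z. real (omega' n m (snd z)))
    \<le> measure_pmf.expectation (coupling n m x) (\<lambda>z. real (max_load (slots n x) m (fst z)))"
proof -
  let ?E = "measure_pmf.expectation (coupling n m x) :: (_ \<Rightarrow> real) \<Rightarrow> real"
  have fin: "finite (set_pmf (coupling n m x))" by (rule finite_coupling)
  have "\<exists>w. w < m \<and> omega' n m S = card {v \<in> {..<n}. w \<in> S v}" for S
    by (rule omega'_attained[of S]) auto
  then obtain \<beta> where \<beta>: "\<And>S. \<beta> S < m" "\<And>S. omega' n m S = card {v \<in> {..<n}. \<beta> S \<in> S v}"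
    by metis
  have "?E (\<lambda>z. real (omega' n m (snd z))) = ?E (\<lambda>z. \<Sum>v<n. of_bool (\<beta> (snd z) \<in> snd z v))"
    unfolding \<beta>(2) by (subst card_eq_sum_of_bool) auto
  also have "\<dots> = (\<Sum>v<n. ?E (\<lambda>z. of_bool (\<beta> (snd z) \<in> snd z v)))"
    by (rule expectation_sum_finite[OF fin])
  also have "\<dots> = (\<Sum>v<n. \<Sum>i<x v. ?E (\<lambda>z. of_bool (fst z (v, i) = \<beta> (snd z))))"
  proof (rule sum.cong[OF refl])
    fix v assume v: "v \<in> {..<n}"
    show "?E (\<lambda>z. of_bool (\<beta> (snd z) \<in> snd z v)) = (\<Sum>i<x v. ?E (\<lambda>z. of_bool (fst z (v, i) = \<beta> (snd z))))"
    proof (cases "x v = 0")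
      \<comment> \<open>A vertex without balls owns no attribute; it is treated apart because the
        other case divides by \<open>x v\<close>.\<close>
      case True
      have "?E (\<lambda>z. of_bool (\<beta> (snd z) \<in> snd z v)) = ?E (\<lambda>z. 0)"
      proof (rule expectation_cong_pmf)
        fix z assume "z \<in> set_pmf (coupling n m x)"
        then have "snd z \<in> set_families n m x" using set_coupling(3) by (cases z) auto
        then have "snd z v \<subseteq> {..<m}" "card (snd z v) = 0"
          using v True by (auto simp: set_families_def PiE_dflt_def)
        then have "snd z v = {}" using finite_subset by fastforce
        then show "of_bool (\<beta> (snd z) \<in> snd z v) = (0 :: real)" by simp
      qed
      then show ?thesis using True by simp
    next
      case False
      have "?E (\<lambda>z. of_bool (fst z (v, i) = \<beta> (snd z))) = ?E (\<lambda>z. of_bool (\<beta> (snd z) \<in> snd z v)) / real (x v)"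
        if "i < x v" for i
        using coupling_ball_in_selected_bin[where v = v and i = i and \<beta> = \<beta>] that v False
        by (simp add: slots_def eq_divide_eq mult.commute)
      then show ?thesis using False by simp
    qed
  qed
  also have "\<dots> = ?E (\<lambda>z. \<Sum>v<n. \<Sum>i<x v. of_bool (fst z (v, i) = \<beta> (snd z)))"
    by (simp only: expectation_sum_finite[OF fin])
  also have "\<dots> \<le> ?E (\<lambda>z. real (max_load (slots n x) m (fst z)))"
  proof (rule expectation_mono_finite[OF fin])
    fix z
    have "(\<Sum>v<n. \<Sum>i<x v. of_bool (fst z (v, i) = \<beta> (snd z))) = real (load (slots n x) (fst z) (\<beta> (snd z)))"
      unfolding load_slots of_nat_sum by (intro sum.cong refl card_eq_sum_of_bool[symmetric]) simp
    also have "\<dots> \<le> real (max_load (slots n x) m (fst z))"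
      using load_le_max_load[OF \<beta>(1)] by simp
    finally show "(\<Sum>v<n. \<Sum>i<x v. of_bool (fst z (v, i) = \<beta> (snd z)))
        \<le> real (max_load (slots n x) m (fst z))" .
  qed
  finally show ?thesis .
qed

text \<open>Both \<open>omega'\<close> and the maximal load dominate the maximal number of distinct groups in a bin,
  and the latter falls short of the maximal load only by repetitions in the top bin.\<close>
lemma abs_omega'_max_load_le:
  assumes "z \<in> set_pmf (coupling n m x)"
  defines "b \<equiv> fst z"
  shows "\<bar>real (omega' n m (snd z)) - real (max_load (slots n x) m b)\<bar>
    \<le> real (omega' n m (snd z)) - real (max_load (slots n x) m b)
      + (\<Sum>v<n. \<Sum>(i, j)\<in>(SIGMA i:{..<x v}. {..<x v} - {i}).
          of_bool (b (v, i) = top_bin (slots n x) m b \<and> b (v, j) = top_bin (slots n x) m b))"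
proof -
  let ?t = "top_bin (slots n x) m b" and ?M = "max_load (slots n x) m b"
  let ?D = "\<lambda>v. SIGMA i:{..<x v}. {..<x v} - {i}"
  let ?c = "\<lambda>v. card {i \<in> {..<x v}. b (v, i) = ?t}"
  have "snd z \<in> compatible n m x b"
    using assms set_coupling(2) by (cases z) auto
  then have "b (v, i) \<in> snd z v" if "v < n" "i < x v" for v i
    using that by (auto simp: compatible_def slots_def)
  then have "distinct_load n x b ?t \<le> card {v \<in> {..<n}. ?t \<in> snd z v}"
    unfolding distinct_load_def by (intro card_mono subsetI) fastforce+
  also have "\<dots> \<le> omega' n m (snd z)"
    unfolding omega'_def by (rule Max_ge) (use top_bin(1)[OF m] in auto)
  finally have d: "distinct_load n x b ?t \<le> omega' n m (snd z)" .
  have M: "?M = (\<Sum>v<n. ?c v)"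
    using top_bin(2)[OF m, of "slots n x" b] load_slots[of b ?t] by simp
  have "real (distinct_load n x b ?t) = (\<Sum>v<n. of_bool (\<exists>i<x v. b (v, i) = ?t))"
    unfolding distinct_load_def by (rule card_eq_sum_of_bool) simp
  also have "\<dots> = (\<Sum>v<n. of_bool (?c v \<noteq> 0))"
    by (intro sum.cong refl) auto
  finally have dl: "real (distinct_load n x b ?t) = (\<Sum>v<n. of_bool (?c v \<noteq> 0))" .
  have pairs: "(\<Sum>(i, j)\<in>?D v. of_bool (b (v, i) = ?t \<and> b (v, j) = ?t)) = real (?c v * (?c v - 1))" for v
  proof -
    let ?A = "{i \<in> {..<x v}. b (v, i) = ?t}"
    have "(\<Sum>(i, j)\<in>?D v. of_bool (b (v, i) = ?t \<and> b (v, j) = ?t))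
        = (\<Sum>z\<in>?D v. of_bool (b (v, fst z) = ?t \<and> b (v, snd z) = ?t) :: real)"
      by (intro sum.cong refl) (auto split: prod.splits)
    also have "\<dots> = real (card {z \<in> ?D v. b (v, fst z) = ?t \<and> b (v, snd z) = ?t})"
      by (rule card_eq_sum_of_bool[symmetric]) auto
    also have "{z \<in> ?D v. b (v, fst z) = ?t \<and> b (v, snd z) = ?t} = (SIGMA i:?A. ?A - {i})"
      by auto
    also have "card \<dots> = ?c v * (?c v - 1)" by (subst card_SigmaI) auto
    finally show ?thesis .
  qed
  \<comment> \<open>For \<open>c\<close> balls of one vertex in the bin, the excess over a single
    ball is at most half the number of ordered pairs.\<close>
  have "2 * (real c - of_bool (c \<noteq> 0)) \<le> real (c * (c - 1))" for c :: nat
  proof (cases "c \<le> 1")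
    case True
    then show ?thesis by (cases "c = 0") auto
  next
    case False
    then have "2 * real (c - 1) \<le> real c * real (c - 1)"
      by (intro mult_right_mono) auto
    then show ?thesis using False by (simp add: of_nat_diff)
  qed
  then have "(\<Sum>v<n. 2 * (real (?c v) - of_bool (?c v \<noteq> 0))) \<le> (\<Sum>v<n. real (?c v * (?c v - 1)))"
    by (rule sum_mono)
  then have "2 * (real ?M - real (distinct_load n x b ?t)) \<le> (\<Sum>v<n. real (?c v * (?c v - 1)))"
    by (simp only: M dl sum_distrib_left[symmetric] sum_subtractf of_nat_sum)
  moreover have "(\<Sum>v<n. real (?c v * (?c v - 1))) \<ge> 0" by (rule sum_nonneg) simp
  \<comment> \<open>The absolute value exceeds the signed difference by twice the shortfall of
    \<open>w\<close> below \<open>M\<close>. The signed part is kept because its mean is controlled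
    by \<open>expectation_omega'_le\<close>.\<close>
  moreover have "\<bar>w - M\<bar> \<le> w - M + s" if "2 * (M - d) \<le> s" "0 \<le> s" "d \<le> w" for s M d w :: real
    using that by (simp add: abs_if)
  ultimately show ?thesis
    unfolding pairs using of_nat_mono[OF d, where ?'a = real] by blast
qed

text \<open>In the coupling inequality the signed part has mean at most 0, so only pairs of balls of
  one vertex in the top bin remain; by exchangeability all pairs have the same probability.\<close>

lemma dTV_set_families_le:
  assumes T: "2 \<le> (\<Sum>v<n. x v)"
  defines "N \<equiv> \<Sum>v<n. x v"
  shows "dTV (map_pmf (omega' n m) (pmf_of_set (set_families n m x))) (max_load_pmf N m)
    \<le> real (\<Sum>v<n. x v * (x v - 1)) * max_load_pairs_mean N m / real (N * (N - 1))"
proof -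
  let ?C = "coupling n m x" and ?I = "slots n x"
  let ?E = "measure_pmf.expectation ?C :: (_ \<Rightarrow> real) \<Rightarrow> real"
  let ?B = "measure_pmf.expectation (throws ?I m) :: (_ \<Rightarrow> real) \<Rightarrow> real"
  let ?D = "\<lambda>v. SIGMA i:{..<x v}. {..<x v} - {i}"
  let ?h = "\<lambda>v p b. of_bool (b (v, fst p) = top_bin ?I m b \<and> b (v, snd p) = top_bin ?I m b) :: real"
  have fin: "finite (set_pmf ?C)" by (rule finite_coupling)
  have finI: "finite ?I" by (rule finite_slots)
  have card: "card ?I = N" by (simp add: card_slots N_def)
  have int: "integrable ?C f" for f :: "_ \<Rightarrow> real" by (rule integrable_measure_pmf_finite[OF fin])
  have O: "map_pmf (omega' n m) (pmf_of_set (set_families n m x)) = map_pmf (\<lambda>z. omega' n m (snd z)) ?C"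
    by (simp add: coupling_sets[symmetric] map_pmf_comp)
  have B: "?B f = ?E (\<lambda>z. f (fst z))" for f
    by (simp add: coupling_balls[symmetric])
  have L: "max_load_pmf N m = map_pmf (\<lambda>z. max_load ?I m (fst z)) ?C"
    using max_load_pmf_eq[OF finI m]
    by (simp add: card coupling_balls[symmetric] map_pmf_comp)
  have "dTV (map_pmf (omega' n m) (pmf_of_set (set_families n m x))) (max_load_pmf N m)
      \<le> ?E (\<lambda>z. \<bar>real (omega' n m (snd z)) - real (max_load ?I m (fst z))\<bar>)"
    unfolding O L by (rule dTV_map_le[OF fin])
  also have "\<dots> \<le> ?E (\<lambda>z. (real (omega' n m (snd z)) - real (max_load ?I m (fst z)))
      + (\<Sum>v<n. \<Sum>p\<in>?D v. ?h v p (fst z)))"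
    using abs_omega'_max_load_le by (intro expectation_mono_finite[OF fin]) (simp add: case_prod_beta')
  also have "\<dots> = ?E (\<lambda>z. real (omega' n m (snd z))) - ?E (\<lambda>z. real (max_load ?I m (fst z)))
      + ?E (\<lambda>z. \<Sum>v<n. \<Sum>p\<in>?D v. ?h v p (fst z))"
    by (simp only: Bochner_Integration.integral_add[OF int int] Bochner_Integration.integral_diff[OF int int])
  also have "\<dots> \<le> ?E (\<lambda>z. \<Sum>v<n. \<Sum>p\<in>?D v. ?h v p (fst z))"
    using expectation_omega'_le by linarith
  also have "\<dots> = (\<Sum>v<n. \<Sum>p\<in>?D v. ?B (?h v p))"
    by (simp only: expectation_sum_finite[OF fin] B)
  also have "\<dots> = (\<Sum>v<n. \<Sum>p\<in>?D v. max_load_pairs_mean N m / real (N * (N - 1)))"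
  proof (intro sum.cong refl)
    fix v p assume v: "v \<in> {..<n}" and p: "p \<in> ?D v"
    have "real (card ?I * (card ?I - 1)) * ?B (?h v p) = ?B (\<lambda>f. real (max_load ?I m f * (max_load ?I m f - 1)))"
      by (rule expectation_pair_in_top_bin[OF finI m]) (use v p in \<open>auto simp: slots_def\<close>)
    moreover have "\<dots> = max_load_pairs_mean N m"
      using max_load_pmf_eq[OF finI m] by (simp add: max_load_pairs_mean_def card)
    moreover have "real (N * (N - 1)) \<noteq> 0" 
      unfolding of_nat_eq_0_iff using T[folded N_def] by auto
    ultimately show "?B (?h v p) = max_load_pairs_mean N m / real (N * (N - 1))"
      by (simp only: card) (simp only: eq_divide_eq mult.commute simp_thms if_True if_False)
  qed
  also have "\<dots> = (\<Sum>v<n. real (card (?D v))) * (max_load_pairs_mean N m / real (N * (N - 1)))"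
    by (simp only: sum_constant sum_distrib_right)
  also have "(\<Sum>v<n. real (card (?D v))) = real (\<Sum>v<n. x v * (x v - 1))"
    by (simp add: card_SigmaI)
  finally show ?thesis by simp
qed

end

subsection \<open>Random sizes of the attribute sets\<close>

lemma expectation_bind_finite:
  fixes h :: "'b \<Rightarrow> real"
  assumes "finite (set_pmf p)" "\<And>a. a \<in> set_pmf p \<Longrightarrow> finite (set_pmf (f a))"
  shows "measure_pmf.expectation (bind_pmf p f) h
    = measure_pmf.expectation p (\<lambda>a. measure_pmf.expectation (f a) h)"
  by (subst pmf_expectation_bind[OF assms(1,2)], simp, simp)
    (subst integral_measure_pmf[OF assms(1)], auto)

text \<open>Additivity of the variance for independent centred summands, by splitting off one
  coordinate: the cross term has the mean of \<open>h\<close> as a factor and vanishes.\<close>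

lemma expectation_square_sum_Pi_pmf:
  fixes h :: "'b \<Rightarrow> real"
  assumes "finite I" and fin: "finite (set_pmf P)" and h: "measure_pmf.expectation P h = 0"
  shows "measure_pmf.expectation (Pi_pmf I d (\<lambda>_. P)) (\<lambda>f. (\<Sum>i\<in>I. h (f i)) ^ 2)
    = card I * measure_pmf.expectation P (\<lambda>y. h y ^ 2)"
  using assms(1)
proof (induction I)
  case empty
  then show ?case by simp
next
  case (insert a I)
  let ?q = "Pi_pmf I d (\<lambda>_. P)"
  let ?E = "measure_pmf.expectation ?q :: (_ \<Rightarrow> real) \<Rightarrow> real"
  let ?s = "\<lambda>f. \<Sum>i\<in>I. h (f i)"
  have finq: "finite (set_pmf ?q)"
    unfolding set_Pi_pmf[OF insert.hyps(1)] using insert.hyps(1) fin by auto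
  have intq: "integrable ?q g" for g :: "_ \<Rightarrow> real" by (rule integrable_measure_pmf_finite[OF finq])
  have intp: "integrable P g" for g :: "_ \<Rightarrow> real" by (rule integrable_measure_pmf_finite[OF fin])
  have s: "(\<Sum>i\<in>I. h (if i = a then y else f i)) = ?s f" for f y
    using insert.hyps(2) by (intro sum.cong) auto
  have "measure_pmf.expectation (Pi_pmf (insert a I) d (\<lambda>_. P)) (\<lambda>f. (\<Sum>i\<in>insert a I. h (f i)) ^ 2)
      = measure_pmf.expectation P (\<lambda>y. ?E (\<lambda>f. (h y + ?s f) ^ 2))"
    using insert.hyps fin finq
    by (simp add: Pi_pmf_insert' expectation_bind_finite s)
  also have "\<dots> = measure_pmf.expectation P (\<lambda>y. h y ^ 2 + 2 * ?E ?s * h y + ?E (\<lambda>f. ?s f ^ 2))"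
  proof (rule arg_cong[where f = "measure_pmf.expectation P"], rule ext)
    fix y
    have "?E (\<lambda>f. (h y + ?s f) ^ 2) = ?E (\<lambda>f. h y ^ 2 + 2 * h y * ?s f + ?s f ^ 2)"
      by (simp add: power2_sum algebra_simps)
    also have "\<dots> = h y ^ 2 + 2 * h y * ?E ?s + ?E (\<lambda>f. ?s f ^ 2)"
      by (simp add: Bochner_Integration.integral_add[OF intq intq] del: Bochner_Integration.integral_sum)
    finally show "?E (\<lambda>f. (h y + ?s f) ^ 2) = h y ^ 2 + 2 * ?E ?s * h y + ?E (\<lambda>f. ?s f ^ 2)"
      by (simp only: mult_ac)
  qed
  also have "\<dots> = measure_pmf.expectation P (\<lambda>y. h y ^ 2) + ?E (\<lambda>f. ?s f ^ 2)"
    by (simp add: Bochner_Integration.integral_add[OF intp intp] h del: Bochner_Integration.integral_sum)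
  finally show ?case
    using insert by (simp add: algebra_simps)
qed

text \<open>All sizes can be drawn first; given them, the product of uniform laws is uniform on the
  product. The support condition ensures that subsets of these sizes exist.\<close>

lemma attr_sets_pmf_eq:
  assumes "set_pmf P \<subseteq> {..m}"
  shows "attr_sets_pmf n m P = bind_pmf (Pi_pmf {..<n} 0 (\<lambda>_. P)) (\<lambda>x. pmf_of_set (set_families n m x))"
proof -
  have "attr_sets_pmf n m P = bind_pmf (Pi_pmf {..<n} 0 (\<lambda>_. P))
      (\<lambda>x. Pi_pmf {..<n} {} (\<lambda>v. pmf_of_set {S. S \<subseteq> {..<m} \<and> card S = x v}))"
    unfolding attr_sets_pmf_def attr_set_pmf_def by (rule Pi_pmf_bind) simp
  also have "\<dots> = bind_pmf (Pi_pmf {..<n} 0 (\<lambda>_. P)) (\<lambda>x. pmf_of_set (set_families n m x))"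
  proof (rule bind_pmf_cong[OF refl])
    fix x assume "x \<in> set_pmf (Pi_pmf {..<n} 0 (\<lambda>_. P))"
    then have x: "x v \<le> m" if "v < n" for v
      using assms that by (auto simp: set_Pi_pmf PiE_dflt_def)
    have "{S. S \<subseteq> {..<m} \<and> card S = x v} \<noteq> {}" if "v < n" for v
      using obtain_subset_with_card_n[of "x v" "{..<m}"] x[OF that] by auto
    then show "Pi_pmf {..<n} {} (\<lambda>v. pmf_of_set {S. S \<subseteq> {..<m} \<and> card S = x v}) = pmf_of_set (set_families n m x)"
      unfolding set_families_def by (intro Pi_pmf_of_set) auto
  qed
  finally show ?thesis .
qed

section \<open>Explicit error bounds\<close>

text \<open>The threshold \<open>?t\<close> is chosen to make the two terms of
  \<open>max_load_mean_le\<close> that depend on \<open>t\<close> equal.\<close>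

lemma max_load_mean_quotient_le:
  assumes "0 < m" "0 < K"
  shows "max_load_mean K m / real K \<le> 2 / real K + 2 * real m powr (-2/3)"
proof -
  let ?t = "real K * real m powr (-2/3)"
  have t: "0 < ?t" using assms by simp
  have p: "real m powr (-2/3) * real m powr (-2/3) * real m powr (-2/3) = 1 / real m ^ 2"
    using assms by (simp add: powr_add[symmetric] powr_minus_divide powr_realpow)
  have "real K ^ 3 / (real m ^ 2 * ?t ^ 2) = ?t"
  proof -
    have "real K ^ 3 / real m ^ 2 = ?t ^ 3"
      using p by (simp add: power3_eq_cube mult_ac)
    moreover have "s ^ 3 / s ^ 2 = s" if "0 < s" for s :: real
      using that by (simp add: power3_eq_cube power2_eq_square)
    ultimately show ?thesis using t by (simp only: divide_divide_eq_left[of _ "real m ^ 2", symmetric])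
  qed
  then have "max_load_mean K m \<le> 2 + 2 * ?t"
    using max_load_mean_le[OF assms(1) t, of K] by linarith
  then have "max_load_mean K m / real K \<le> (2 + 2 * ?t) / real K"
    by (rule divide_right_mono) simp
  also have "\<dots> = 2 / real K + 2 * real m powr (-2/3)"
    using assms by (simp add: add_divide_distrib)
  finally show ?thesis .
qed

text \<open>The same threshold turns the tail term of \<open>max_load_pairs_mean_le\<close> into
  \<open>?t ^ 2\<close>.\<close>

lemma max_load_pairs_mean_quotient_le:
  assumes "0 < m" "2 \<le> K"
  shows "max_load_pairs_mean K m / real (K * (K - 1)) \<le> 16 / real K ^ 2 + 6 * real m powr (-4/3)"
proof -
  let ?a = "real m powr (-2/3)"
  let ?t = "real K * ?a"
  have t: "0 < ?t" using assms by simp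
  have a2: "?a ^ 2 = real m powr (-4/3)"
    using assms by (simp add: power2_eq_square powr_add[symmetric])
  have p: "?a ^ 3 = 1 / real m ^ 2"
    using assms by (simp add: power3_eq_cube powr_add[symmetric] powr_minus_divide powr_realpow)
  have "real K ^ 3 / (real m ^ 2 * ?t) = ?t ^ 2"
  proof -
    have "real K ^ 3 / real m ^ 2 = ?t ^ 3"
      using p by (simp add: power_mult_distrib)
    moreover have "s ^ 3 / s = s ^ 2" if "0 < s" for s :: real
      using that by (simp add: power3_eq_cube power2_eq_square)
    ultimately show ?thesis using t by (simp only: divide_divide_eq_left[of _ "real m ^ 2", symmetric])
  qed
  moreover have "(2 + ?t) ^ 2 \<le> 8 + 2 * ?t ^ 2"
    using sum_squares_bound[of 2 ?t] by (simp add: power2_sum)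
  ultimately have "max_load_pairs_mean K m \<le> 8 + 3 * ?t ^ 2"
    using max_load_pairs_mean_le[OF assms(1) t, of K] by linarith
  \<comment> \<open>For \<open>K \<ge> 2\<close> there are at least \<open>K ^ 2 / 2\<close> ordered
    pairs; this doubles the constants 8 and 3 to 16 and 6.\<close>
  moreover have K: "real K ^ 2 / 2 \<le> real (K * (K - 1))"
    using assms by (simp add: power2_eq_square of_nat_diff field_simps)
  moreover have "0 < real K ^ 2 / 2" using assms by simp
  ultimately have "max_load_pairs_mean K m / real (K * (K - 1)) \<le> (8 + 3 * ?t ^ 2) / (real K ^ 2 / 2)"
    by (intro frac_le) auto
  also have "\<dots> = 16 / real K ^ 2 + 6 * ?a ^ 2"
    using assms by (simp add: field_simps power_mult_distrib)
  finally show ?thesis by (simp only: a2)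
qed

text \<open>The first summand accounts for untypically small \<open>T\<close>.\<close>
lemma dTV_given_sizes_le:
  assumes m: "0 < m" and x: "\<And>v. v < n \<Longrightarrow> x v \<le> m" and \<mu>: "4 \<le> \<mu>"
  defines "T \<equiv> \<Sum>v<n. x v" and "N \<equiv> nat \<lfloor>\<mu>\<rfloor>"
  shows "dTV (map_pmf (omega' n m) (pmf_of_set (set_families n m x))) (max_load_pmf N m)
    \<le> 4 * (real T - \<mu>) ^ 2 / \<mu> ^ 2
      + real (\<Sum>v<n. x v ^ 2) * (64 / \<mu> ^ 2 + 6 * real m powr (-4/3))
      + (1 + \<bar>real T - \<mu>\<bar>) * (4 / \<mu> + 2 * real m powr (-2/3))"
    (is "?d \<le> ?a + ?b + ?c")
proof -
  have nonneg: "0 \<le> ?a" "0 \<le> ?b" "0 \<le> ?c" using \<mu> by (auto intro!: mult_nonneg_nonneg add_nonneg_nonneg sum_nonneg)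
  \<comment> \<open>Rounding moves \<open>\<mu>\<close> by at most 1, the source of the 1 in the
    last error term; \<open>4 \<le> \<mu>\<close> keeps \<open>N\<close> above half of
    \<open>\<mu>\<close>.\<close>
  have N: "real N \<le> \<mu>" "\<mu> - 1 \<le> real N" "\<mu> / 2 \<le> real N" "0 < N"
    using \<mu> unfolding N_def by linarith+
  show ?thesis
  proof (cases "real T < \<mu> / 2")
    case True
    then have "(\<mu> / 2) ^ 2 \<le> (\<mu> - real T) ^ 2"
      using \<mu> by (intro power_mono) auto
    then have "1 \<le> ?a"
      using \<mu> by (simp add: power2_commute[of \<mu>] power_divide)
    then show ?thesis using dTV_le_1[of "map_pmf (omega' n m) (pmf_of_set (set_families n m x))" "max_load_pmf N m"] nonneg by linarith
  next
    case False
    then have T: "2 \<le> T" "\<mu> / 2 \<le> real T" using \<mu> by auto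
    have "dTV (map_pmf (omega' n m) (pmf_of_set (set_families n m x))) (max_load_pmf T m)
        \<le> real (\<Sum>v<n. x v * (x v - 1)) * (max_load_pairs_mean T m / real (T * (T - 1)))"
      using dTV_set_families_le[OF m, of n x] x T(1) by (simp add: T_def)
    also have "\<dots> \<le> real (\<Sum>v<n. x v ^ 2) * (64 / \<mu> ^ 2 + 6 * real m powr (-4/3))"
    proof (rule mult_mono)
      show "real (\<Sum>v<n. x v * (x v - 1)) \<le> real (\<Sum>v<n. x v ^ 2)"
        unfolding of_nat_le_iff by (intro sum_mono) (simp add: power2_eq_square)
      have "(\<mu> / 2) ^ 2 \<le> real T ^ 2" using T(2) \<mu> by (intro power_mono) auto
      then have "16 / real T ^ 2 \<le> 16 / (\<mu> / 2) ^ 2"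
        using \<mu> by (intro divide_left_mono mult_pos_pos) auto
      then have "16 / real T ^ 2 \<le> 64 / \<mu> ^ 2" by (simp add: power_divide)
      then show "max_load_pairs_mean T m / real (T * (T - 1)) \<le> 64 / \<mu> ^ 2 + 6 * real m powr (-4/3)"
        by (intro order.trans[OF max_load_pairs_mean_quotient_le[OF m T(1)]] add_right_mono)
      show "0 \<le> max_load_pairs_mean T m / real (T * (T - 1))"
        unfolding max_load_pairs_mean_def by (intro divide_nonneg_nonneg integral_nonneg_AE) auto
    qed (simp add: sum_nonneg)
    finally have 1: "dTV (map_pmf (omega' n m) (pmf_of_set (set_families n m x))) (max_load_pmf T m) \<le> ?b" .
    have 2: "dTV (max_load_pmf T m) (max_load_pmf N m) \<le> ?c"
    proof -
      \<comment> \<open>Ordering the two numbers of balls lets one monotone comparison cover both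
        cases; the larger is at least \<open>\<mu> / 2\<close>.\<close>
      define K where "K = max T N"
      define k where "k = min T N"
      have K: "0 < K" "k \<le> K" "\<mu> / 2 \<le> real K" using N by (auto simp: K_def k_def)
      have "dTV (max_load_pmf T m) (max_load_pmf N m) = dTV (max_load_pmf k m) (max_load_pmf K m)"
        by (cases "T \<le> N") (simp_all add: K_def k_def max_def min_def dTV_commute)
      also have "\<dots> \<le> real (K - k) * (max_load_mean K m / real K)"
        using dTV_max_load_le[OF m K(2,1)] by simp
      also have "\<dots> \<le> (1 + \<bar>real T - \<mu>\<bar>) * (4 / \<mu> + 2 * real m powr (-2/3))"
      proof (rule mult_mono)
        have "real (K - k) = \<bar>real T - real N\<bar>"
          by (auto simp: K_def k_def max_def min_def of_nat_diff)
        then show "real (K - k) \<le> 1 + \<bar>real T - \<mu>\<bar>" using N by linarith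
        have "2 / real K \<le> 2 / (\<mu> / 2)" using K \<mu> by (intro divide_left_mono) auto
        then show "max_load_mean K m / real K \<le> 4 / \<mu> + 2 * real m powr (-2/3)"
          using max_load_mean_quotient_le[OF m K(1)] by simp
        show "0 \<le> max_load_mean K m / real K"
          unfolding max_load_mean_def by (intro divide_nonneg_nonneg integral_nonneg_AE) auto
      qed simp
      finally show ?thesis .
    qed
    show ?thesis
      using dTV_triangle[of "map_pmf (omega' n m) (pmf_of_set (set_families n m x))" "max_load_pmf N m" "max_load_pmf T m"]
        1 2 nonneg by linarith
  qed
qed

text \<open>Averages the bound for given sizes: their total has mean \<open>\<mu>\<close> and
  variance \<open>m * V\<close>, their squares sum to \<open>m * (V + y ^ 2)\<close> on average, and
  the mean absolute deviation of the total follows from its variance.\<close>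

lemma dTV_omega'_le:
  assumes m: "0 < m" and n: "0 < n" and supp: "set_pmf P \<subseteq> {..m}"
  defines "y \<equiv> EY n m P" and "V \<equiv> VarY n m P" and "\<mu> \<equiv> sqrt (real m * real n) * EY n m P"
  assumes \<mu>: "4 \<le> \<mu>"
  shows "dTV (omega'_pmf n m P) (max_load_pmf (nat \<lfloor>\<mu>\<rfloor>) m)
    \<le> 4 * (real m * V) / \<mu> ^ 2
      + real m * (V + y ^ 2) * (64 / \<mu> ^ 2 + 6 * real m powr (-4/3))
      + (1 + (V + 1) * sqrt (real m) / 2) * (4 / \<mu> + 2 * real m powr (-2/3))"
proof -
  let ?X = "Pi_pmf {..<n} 0 (\<lambda>_. P)" and ?N = "nat \<lfloor>\<mu>\<rfloor>"
  let ?E = "measure_pmf.expectation ?X :: (_ \<Rightarrow> real) \<Rightarrow> real"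
  let ?P = "measure_pmf.expectation P :: (_ \<Rightarrow> real) \<Rightarrow> real"
  let ?T = "\<lambda>x. \<Sum>v<n. x v :: nat"
  let ?r = "sqrt (real n / real m)"
  define e where "e = ?P real"
  have finP: "finite (set_pmf P)" using supp finite_subset by blast
  have finX: "finite (set_pmf ?X)" using finP by (subst set_Pi_pmf) auto
  have intX: "integrable ?X f" for f :: "_ \<Rightarrow> real" by (rule integrable_measure_pmf_finite[OF finX])
  have intP: "integrable P f" for f :: "_ \<Rightarrow> real" by (rule integrable_measure_pmf_finite[OF finP])
  have r2: "?r ^ 2 = real n / real m" by simp
  have y: "y = ?r * e" by (simp add: y_def EY_def e_def)
  \<comment> \<open>The scalings cancel, so \<open>\<mu>\<close> is the mean of the total of the
    sizes.\<close>
  have "?r * sqrt (real m * real n) = real n"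
    using m by (simp add: real_sqrt_mult[symmetric] real_sqrt_abs2)
  then have \<mu>_eq: "\<mu> = real n * e" by (simp add: \<mu>_def y_def[symmetric] y mult_ac)
  have "V = ?P (\<lambda>k. ?r ^ 2 * (real k - e) ^ 2)"
    unfolding V_def VarY_def EY_def[symmetric] y_def[symmetric] y
    by (simp add: right_diff_distrib[symmetric] power_mult_distrib del: real_sqrt_pow2_iff)
  then have V: "real m * V = real n * ?P (\<lambda>k. (real k - e) ^ 2)"
    using m by (simp add: r2)
  have V0: "0 \<le> V" unfolding V_def VarY_def by (rule integral_nonneg_AE) simp
  have var: "?E (\<lambda>x. (real (?T x) - \<mu>) ^ 2) = real m * V"
  proof -
    have "?E (\<lambda>x. (real (?T x) - \<mu>) ^ 2) = ?E (\<lambda>x. (\<Sum>v<n. real (x v) - e) ^ 2)"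
      by (simp add: sum_subtractf \<mu>_eq)
    also have "\<dots> = real (card {..<n}) * ?P (\<lambda>k. (real k - e) ^ 2)"
      by (rule expectation_square_sum_Pi_pmf[OF _ finP]) (simp_all add: e_def intP)
    finally show ?thesis by (simp add: V)
  qed
  have sq: "?E (\<lambda>x. real (\<Sum>v<n. x v ^ 2)) = real m * (V + y ^ 2)"
  proof -
    have "?P (\<lambda>k. (real k - e) ^ 2) = ?P (\<lambda>k. real k ^ 2) - e ^ 2"
      unfolding e_def by (rule measure_pmf.variance_eq) (rule intP)+
    then have "?P (\<lambda>k. real k ^ 2) = ?P (\<lambda>k. (real k - e) ^ 2) + e ^ 2" by simp
    moreover have "?E (\<lambda>x. real (\<Sum>v<n. x v ^ 2)) = ?E (\<lambda>x. \<Sum>v<n. real (x v) ^ 2)" by simp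
    moreover have "\<dots> = real n * ?P (\<lambda>k. real k ^ 2)"
      by (subst expectation_sum_Pi_pmf[where h = "\<lambda>k. real k ^ 2"]) (simp_all add: intP)
    moreover have "real m * y ^ 2 = real n * e ^ 2" using m by (simp add: y power_mult_distrib r2)
    ultimately show ?thesis by (simp only: distrib_left V)
  qed
  have abs: "?E (\<lambda>x. \<bar>real (?T x) - \<mu>\<bar>) \<le> (V + 1) * sqrt (real m) / 2"
  proof -
    let ?s = "sqrt (real m)"
    have "?E (\<lambda>x. \<bar>real (?T x) - \<mu>\<bar>) \<le> ?E (\<lambda>x. (real (?T x) - \<mu>) ^ 2 / (2 * ?s) + ?s / 2)"
    proof (rule expectation_mono_finite[OF finX])
      fix x
      \<comment> \<open>The inequality of arithmetic and geometric means, weighted by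
        \<open>sqrt m\<close>, the scale of the fluctuations of the total.\<close>
      have "0 \<le> (\<bar>real (?T x) - \<mu>\<bar> - ?s) ^ 2" by simp
      then have "2 * ?s * \<bar>real (?T x) - \<mu>\<bar> \<le> (real (?T x) - \<mu>) ^ 2 + ?s ^ 2"
        by (simp add: power2_diff mult_ac del: real_sqrt_pow2_iff real_sqrt_pow2)
      then have "\<bar>real (?T x) - \<mu>\<bar> \<le> ((real (?T x) - \<mu>) ^ 2 + ?s ^ 2) / (2 * ?s)"
        using m by (simp add: pos_le_divide_eq mult_ac)
      also have "\<dots> = (real (?T x) - \<mu>) ^ 2 / (2 * ?s) + ?s / 2"
        using m by (simp add: add_divide_distrib real_div_sqrt)
      finally show "\<bar>real (?T x) - \<mu>\<bar> \<le> (real (?T x) - \<mu>) ^ 2 / (2 * ?s) + ?s / 2" .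
    qed
    also have "\<dots> = real m * V / (2 * ?s) + ?s / 2"
      using var by (simp add: Bochner_Integration.integral_add[OF intX intX])
    also have "\<dots> = (?s * ?s) * V / (2 * ?s) + ?s / 2" by simp
    also have "\<dots> = (V + 1) * ?s / 2" using m by (simp add: field_simps del: real_sqrt_mult_self)
    finally show ?thesis .
  qed
  define c1 where "c1 = 64 / \<mu> ^ 2 + 6 * real m powr (-4/3)"
  define c2 where "c2 = 4 / \<mu> + 2 * real m powr (-2/3)"
  have c2: "0 \<le> c2" using \<mu> by (simp add: c2_def)
  \<comment> \<open>Both laws are written as mixtures over the sizes, the maximal load with constant
    components, so that convexity of the distance applies.\<close>
  have "omega'_pmf n m P = bind_pmf ?X (\<lambda>x. map_pmf (omega' n m) (pmf_of_set (set_families n m x)))"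
    by (simp add: omega'_pmf_def attr_sets_pmf_eq[OF supp] map_bind_pmf)
  then have "dTV (omega'_pmf n m P) (bind_pmf ?X (\<lambda>_. max_load_pmf ?N m))
      \<le> ?E (\<lambda>x. dTV (map_pmf (omega' n m) (pmf_of_set (set_families n m x))) (max_load_pmf ?N m))"
    using dTV_bind_le[OF finX] by (simp only:)
  then have "dTV (omega'_pmf n m P) (max_load_pmf ?N m)
      \<le> ?E (\<lambda>x. dTV (map_pmf (omega' n m) (pmf_of_set (set_families n m x))) (max_load_pmf ?N m))"
    by (simp only: bind_pmf_const)
  also have "\<dots> \<le> ?E (\<lambda>x. 4 * (real (?T x) - \<mu>) ^ 2 / \<mu> ^ 2 + real (\<Sum>v<n. x v ^ 2) * c1
      + (1 + \<bar>real (?T x) - \<mu>\<bar>) * c2)"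
  proof (rule expectation_mono_finite[OF finX])
    fix x assume "x \<in> set_pmf ?X"
    then have "x v \<le> m" if "v < n" for v
      using supp that by (auto simp: set_Pi_pmf PiE_dflt_def)
    from dTV_given_sizes_le[OF m this \<mu>]
    show "dTV (map_pmf (omega' n m) (pmf_of_set (set_families n m x))) (max_load_pmf ?N m)
        \<le> 4 * (real (?T x) - \<mu>) ^ 2 / \<mu> ^ 2 + real (\<Sum>v<n. x v ^ 2) * c1
          + (1 + \<bar>real (?T x) - \<mu>\<bar>) * c2"
      unfolding c1_def c2_def .
  qed
  also have "\<dots> = 4 * ?E (\<lambda>x. (real (?T x) - \<mu>) ^ 2) / \<mu> ^ 2 + ?E (\<lambda>x. real (\<Sum>v<n. x v ^ 2)) * c1
      + (1 + ?E (\<lambda>x. \<bar>real (?T x) - \<mu>\<bar>)) * c2"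
    by (simp add: Bochner_Integration.integral_add[OF intX intX] del: of_nat_sum Bochner_Integration.integral_sum)
  also have "\<dots> \<le> 4 * (real m * V) / \<mu> ^ 2 + real m * (V + y ^ 2) * c1
      + (1 + (V + 1) * sqrt (real m) / 2) * c2"
    unfolding var sq using abs c2 by (intro add_left_mono mult_right_mono) auto
  finally show ?thesis unfolding c1_def c2_def .
qed

section \<open>Uniform rate and passage to the limit\<close>

text \<open>Since \<open>\<mu>\<close> is at least \<open>c * sqrt (m * n)\<close>, the powers of
  \<open>m\<close> cancel or leave a negative exponent, -1/3 or -1/6; every summand is then small
  once \<open>m\<close> and \<open>n\<close> are large.\<close>

lemma dTV_omega'_bound:
  fixes c C :: real
  assumes m: "0 < m" and n: "0 < n" and supp: "set_pmf P \<subseteq> {..m}"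
    and c: "0 < c" "c \<le> EY n m P" and C: "EY n m P \<le> C" "VarY n m P \<le> C"
    and large: "4 \<le> c * sqrt (real n)"
  shows "dTV (omega'_pmf n m P) (max_load_pmf (nat \<lfloor>sqrt (real m * real n) * EY n m P\<rfloor>) m)
    \<le> 4 * C / c ^ 2 * (1 / real n)
      + (C + C ^ 2) * (64 / c ^ 2 * (1 / real n) + 6 * real m powr (-1/3))
      + (1 + (C + 1) / 2) * (4 / c * (1 / sqrt (real n)) + 2 * real m powr (-1/6))"
proof -
  define y where "y = EY n m P"
  define V where "V = VarY n m P"
  define \<mu> where "\<mu> = sqrt (real m * real n) * y"
  have V0: "0 \<le> V" unfolding V_def VarY_def by (rule integral_nonneg_AE) simp
  have y: "c \<le> y" "y \<le> C" "V \<le> C" and C0: "0 \<le> C" using c C by (auto simp: y_def V_def)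
  have sm: "1 \<le> sqrt (real m)" using m by simp
  have \<mu>_lower: "sqrt (real m) * (c * sqrt (real n)) \<le> \<mu>"
    using mult_right_mono[OF y(1), of "sqrt (real m) * sqrt (real n)"]
    by (simp add: \<mu>_def real_sqrt_mult mult_ac)
  \<comment> \<open>As \<open>m\<close> is at least 1, the assumption on \<open>n\<close> alone
    secures \<open>4 \<le> \<mu>\<close>.\<close>
  have "c * sqrt (real n) \<le> sqrt (real m) * (c * sqrt (real n))"
    using mult_right_mono[OF sm, of "c * sqrt (real n)"] c by simp
  then have \<mu>4: "4 \<le> \<mu>" using large \<mu>_lower by linarith
  have "(sqrt (real m) * (c * sqrt (real n))) ^ 2 \<le> \<mu> ^ 2"
    using \<mu>_lower c by (intro power_mono) auto
  then have sq: "real m * (c ^ 2 * real n) \<le> \<mu> ^ 2" by (simp add: power_mult_distrib)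
  have pos: "0 < real m * (c ^ 2 * real n)" using m n c by simp
  have q2: "real m / \<mu> ^ 2 \<le> 1 / c ^ 2 * (1 / real n)"
  proof -
    have "real m / \<mu> ^ 2 \<le> real m / (real m * (c ^ 2 * real n))"
      using sq pos m n \<mu>4 by (intro divide_left_mono mult_pos_pos) auto
    then show ?thesis using m by simp
  qed
  have q1: "sqrt (real m) / \<mu> \<le> 1 / c * (1 / sqrt (real n))"
  proof -
    have "sqrt (real m) / \<mu> \<le> sqrt (real m) / (sqrt (real m) * (c * sqrt (real n)))"
      using \<mu>_lower \<mu>4 m n c by (intro divide_left_mono mult_pos_pos) auto
    then show ?thesis using m by simp
  qed
  have p1: "real m * real m powr (-4/3) = real m powr (-1/3)"
    using m powr_add[of "real m" 1 "-4/3"] by simp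
  have p2: "sqrt (real m) * real m powr (-2/3) = real m powr (-1/6)"
    using m powr_add[of "real m" "1/2" "-2/3"] by (simp add: powr_half_sqrt)
  have "dTV (omega'_pmf n m P) (max_load_pmf (nat \<lfloor>\<mu>\<rfloor>) m)
    \<le> 4 * (real m * V) / \<mu> ^ 2
      + real m * (V + y ^ 2) * (64 / \<mu> ^ 2 + 6 * real m powr (-4/3))
      + (1 + (V + 1) * sqrt (real m) / 2) * (4 / \<mu> + 2 * real m powr (-2/3))"
    using dTV_omega'_le[OF m n supp] \<mu>4 by (simp add: \<mu>_def y_def V_def)
  also have "4 * (real m * V) / \<mu> ^ 2 \<le> 4 * C / c ^ 2 * (1 / real n)"
  proof -
    have "4 * V * (real m / \<mu> ^ 2) \<le> 4 * C * (1 / c ^ 2 * (1 / real n))"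
      using q2 V0 y C0 by (intro mult_mono) auto
    then show ?thesis by (simp add: mult_ac)
  qed
  also have "real m * (V + y ^ 2) * (64 / \<mu> ^ 2 + 6 * real m powr (-4/3))
      = (V + y ^ 2) * (64 * (real m / \<mu> ^ 2) + 6 * real m powr (-1/3))"
    unfolding p1[symmetric] by (simp add: algebra_simps)
  also have "\<dots> \<le> (C + C ^ 2) * (64 / c ^ 2 * (1 / real n) + 6 * real m powr (-1/3))"
  proof (rule mult_mono)
    show "V + y ^ 2 \<le> C + C ^ 2" using y c by (intro add_mono power_mono) auto
    show "64 * (real m / \<mu> ^ 2) + 6 * real m powr (-1/3) \<le> 64 / c ^ 2 * (1 / real n) + 6 * real m powr (-1/3)"
      using q2 by simp
  qed (use C0 in auto)
  also have "(1 + (V + 1) * sqrt (real m) / 2) * (4 / \<mu> + 2 * real m powr (-2/3))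
      \<le> (1 + (C + 1) / 2) * (4 / c * (1 / sqrt (real n)) + 2 * real m powr (-1/6))"
  proof -
    have alg: "a * s * (4 / \<mu> + 2 * q) = a * (4 * (s / \<mu>) + 2 * (s * q))" for a s q :: real
      by (simp add: algebra_simps)
    have "(V + 1) * sqrt (real m) \<le> (C + 1) * sqrt (real m)"
      using y by (intro mult_right_mono) auto
    moreover have "(1 + (C + 1) / 2) * sqrt (real m) = sqrt (real m) + (C + 1) * sqrt (real m) / 2"
      by (simp add: field_simps)
    \<comment> \<open>The isolated 1 is absorbed by \<open>1 \<le> sqrt m\<close>, leaving a
      constant times \<open>sqrt m\<close>.\<close>
    ultimately have "1 + (V + 1) * sqrt (real m) / 2 \<le> (1 + (C + 1) / 2) * sqrt (real m)"
      using sm by linarith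
    then have "(1 + (V + 1) * sqrt (real m) / 2) * (4 / \<mu> + 2 * real m powr (-2/3))
        \<le> (1 + (C + 1) / 2) * sqrt (real m) * (4 / \<mu> + 2 * real m powr (-2/3))"
      using \<mu>4 by (intro mult_right_mono) auto
    also have "\<dots> = (1 + (C + 1) / 2) * (4 * (sqrt (real m) / \<mu>) + 2 * real m powr (-1/6))"
      unfolding p2[symmetric] by (rule alg)
    also have "\<dots> \<le> (1 + (C + 1) / 2) * (4 / c * (1 / sqrt (real n)) + 2 * real m powr (-1/6))"
      using q1 C0 by (intro mult_left_mono) auto
    finally show ?thesis .
  qed
  finally show ?thesis by (simp add: \<mu>_def y_def)
qed

theorem theorem3:
  fixes m :: "nat \<Rightarrow> nat" and P :: "nat \<Rightarrow> nat pmf"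
  assumes supp: "\<And>n. set_pmf (P n) \<subseteq> {..m n}"
    and m_pos: "\<And>n. m n > 0"
    and m_inf: "filterlim m at_top sequentially"
    and EY_Theta: "(\<lambda>n. EY n (m n) (P n)) \<in> \<Theta>(\<lambda>_. 1)"
    and VarY_O: "(\<lambda>n. VarY n (m n) (P n)) \<in> O(\<lambda>_. 1)"
  shows "(\<lambda>n. dTV (omega'_pmf n (m n) (P n))
                  (max_load_pmf (nat \<lfloor>sqrt (real (m n) * real n) * EY n (m n) (P n)\<rfloor>) (m n)))
         \<longlonglongrightarrow> 0"
proof -
  let ?y = "\<lambda>n. EY n (m n) (P n)" and ?V = "\<lambda>n. VarY n (m n) (P n)"
  \<comment> \<open>Nonnegativity turns the norm bounds of the Landau symbols into bounds on the
    mean itself.\<close>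
  have EY0: "0 \<le> ?y n" for n unfolding EY_def by (rule integral_nonneg_AE) simp
  from EY_Theta have "?y \<in> O(\<lambda>_. 1)" "?y \<in> \<Omega>(\<lambda>_. 1)" by (auto simp: bigtheta_def)
  then obtain C1 c where C1: "eventually (\<lambda>n. norm (?y n) \<le> C1 * norm (1 :: real)) sequentially"
    and c: "0 < c" "eventually (\<lambda>n. norm (?y n) \<ge> c * norm (1 :: real)) sequentially"
    by (elim landau_o.bigE landau_omega.bigE) auto
  from VarY_O obtain C2 where C2: "eventually (\<lambda>n. norm (?V n) \<le> C2 * norm (1 :: real)) sequentially"
    by (elim landau_o.bigE) auto
  define C where "C = max C1 C2"
  let ?U = "\<lambda>n. 4 * C / c ^ 2 * (1 / real n)
      + (C + C ^ 2) * (64 / c ^ 2 * (1 / real n) + 6 * real (m n) powr (-1/3))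
      + (1 + (C + 1) / 2) * (4 / c * (1 / sqrt (real n)) + 2 * real (m n) powr (-1/6))"
  have sqrt_inf: "filterlim (\<lambda>n. sqrt (real n)) at_top sequentially"
    by (rule filterlim_compose[OF sqrt_at_top filterlim_real_sequentially])
  \<comment> \<open>Eventually \<open>n\<close> meets the size condition
    \<open>4 \<le> c * sqrt n\<close> of the explicit bound.\<close>
  have "eventually (\<lambda>n. 4 / c \<le> sqrt (real n)) sequentially"
    using sqrt_inf by (simp add: filterlim_at_top)
  then have "eventually (\<lambda>n. dTV (omega'_pmf n (m n) (P n))
      (max_load_pmf (nat \<lfloor>sqrt (real (m n) * real n) * ?y n\<rfloor>) (m n)) \<le> ?U n) sequentially"
    using C1 c(2) C2 eventually_gt_at_top[of 0]
  proof eventually_elim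
    case (elim n)
    have "4 \<le> c * sqrt (real n)" using elim(1) c(1) by (simp add: pos_divide_le_eq mult.commute)
    then show ?case
      using elim EY0[of n] c(1) by (intro dTV_omega'_bound m_pos supp) (auto simp: C_def)
  qed
  moreover have "?U \<longlonglongrightarrow> 0"
  proof -
    have m: "filterlim (\<lambda>n. real (m n)) at_top sequentially"
      by (rule filterlim_compose[OF filterlim_real_sequentially m_inf])
    have "(\<lambda>n. real (m n) powr (-1/3)) \<longlonglongrightarrow> 0" "(\<lambda>n. real (m n) powr (-1/6)) \<longlonglongrightarrow> 0"
      by (rule tendsto_neg_powr[OF _ m], simp)+
    moreover have "(\<lambda>n. 1 / real n) \<longlonglongrightarrow> 0" by (rule lim_1_over_n)
    moreover have "(\<lambda>n. 1 / sqrt (real n)) \<longlonglongrightarrow> 0"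
      using tendsto_inverse_0_at_top[OF sqrt_inf] by (simp add: inverse_eq_divide)
    ultimately have "?U \<longlonglongrightarrow> 4 * C / c ^ 2 * 0 + (C + C ^ 2) * (64 / c ^ 2 * 0 + 6 * 0)
        + (1 + (C + 1) / 2) * (4 / c * 0 + 2 * 0)"
      by (intro tendsto_add tendsto_mult tendsto_const)
    then show ?thesis by simp
  qed
  ultimately show ?thesis
    by (rule tendsto_sandwich[OF always_eventually[OF allI[OF dTV_nonneg]] _ tendsto_const])
qed

end
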